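(* Let $R=(G,\Phi,\Phi^+)$ be a finite, connected, simply connected, preprincipal and complete (in particular faithful) signed groupoid set, and let $S$ be any connected component of $R^\Box$. Then $S$ is also a finite, connected, simply connected, preprincipal and complete signed groupoid set. Further, the real compression of $S$ is also finite, connected, simply connected, preprincipal and complete, and is in addition real and principal.
   Context: For a groupoid $G$, ${}_aG_b$ is the set of morphisms $b\to a$, ${}_aG$ the set of morphisms with codomain $a$, $1_a$ the identity at $a$; $fg$ means first $g$, then $f$. $G$ is connected if it has an object and there is at least one morphism between any two objects, simply connected if there is at most one morphism from any object to any object. A definitely involuted set is a set $E$ with a fixed-point-free involution $x\mapsto -x$ and a subset $E^+$ such that $E=E^+\sqcup E^-$, $E^-:=-E^+$. A signed groupoid set $R=(G,\Phi,\Phi^+)$ is a groupoid $G$ with a family of definitely involuted sets ${}_a\Phi$ (roots at $a$; positive part ${}_a\Phi^+$), $a\in\mathrm{Ob}(G)$, and maps ${}_aG_b\times{}_b\Phi\to{}_a\Phi$ with $1_b(x)=x$, $f(g(x))=(fg)(x)$, $f(-x)=-f(x)$ (positivity need not be preserved). $R$ is finite if $G$ has finitely many morphisms and all ${}_a\Phi$ are finite; connected / simply connected if $G$ is. A connected component of $R$ is its restriction to a connected component of $G$. For $g\in{}_aG_b$, $\Phi_g:=\{\alpha\in{}_a\Phi^+\mid g^{-1}(\alpha)\in{}_b\Phi^-\}$. $R$ is faithful if $\Phi_g=\emptyset$ implies $g$ is an identity. For faithful $R$, the weak order at $a$ is the partial order on ${}_aG$ with $g\le h\iff\Phi_g\subseteq\Phi_h$.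 $R$ is complete if it is faithful and every weak order is a complete lattice. A morphism $g\in{}_aG$ is atomic if it is an atom of the weak order at $a$, simple if $|\Phi_g|=1$. $R$ is interval finite if $\{h\in{}_aG\mid h\le g\}$ is finite for all $a$ and $g\in{}_aG$. $R$ is preprincipal if it is faithful, interval finite, and for all $g,s\in{}_aG$ with $s$ atomic either $\Phi_s\subseteq\Phi_g$ or $\Phi_s\cap\Phi_g=\emptyset$. $R$ is principal if the simple morphisms generate $G$ and, for every morphism $g$, $|\Phi_g|$ equals the minimal number of factors in an expression of $g$ as a product of simple morphisms ($0$ for identities). A root $\alpha\in{}_a\Phi^+$ is imaginary if $\alpha\notin\Phi_g$ for all $g\in{}_aG$; $-\alpha$ is imaginary iff $\alpha$ is; other roots are real. $R$ is real if it has no imaginary roots. Roots $\alpha,\beta\in{}_a\Phi$ are parallel ($\alpha\sim_a\beta$) if for all $g\in{}_aG$, $g^{-1}\alpha$ and $g^{-1}\beta$ have the same sign. The real compression of $R$ is the signed groupoid set with the same groupoid $G$, whose root set at $a$ is the set of $\sim_a$-classes of real roots in ${}_a\Phi$, with $-[\alpha]=[-\alpha]$, positive roots the classes of positive real roots, and action $g[\alpha]=[g\alpha]$. For faithful $R$, a square is a quadruple $(x,w,y,z)$ of morphisms $w\colon a\to b$, $x\colon b\to d$, $z\colon a\to c$, $y\colon c\to d$ with $xw=yz$ and $x(\Phi_w)=\Phi_y$. The groupoid $G^\Box$ has objects $(a,X)$ with $a\in\mathrm{Ob}(G)$, $X\subseteq{}_aG$; a morphism $(a,X)\to(b,Y)$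 is a morphism $f\colon a\to b$ of $G$ for which there is a bijection $\sigma_f\colon X\to Y$ such that $(f,g,\sigma_f(g),\sigma_f(g)^{-1}fg)$ is a square for all $g\in X$ (equivalently $f(\Phi_g)=\Phi_{\sigma_f(g)}$ for all $g\in X$); composition is as in $G$. $R^\Box=(G^\Box,\Psi,\Psi^+)$ with ${}_{(a,X)}\Psi={}_a\Phi$, ${}_{(a,X)}\Psi^+={}_a\Phi^+$ and action inherited from $G$. *)

theory Defs
  imports "HOL-Algebra.Complete_Lattice"
begin

section \<open>Groupoids\<close>

text \<open>Composition is in functional order: \<open>cmp G f g\<close> is first \<open>g\<close>, then \<open>f\<close>, and is only
  meaningful if \<open>src G f = tgt G g\<close>.\<close>

record ('o, 'm) groupoid =
  obj :: "'o set"
  mor :: "'m set"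
  src :: "'m \<Rightarrow> 'o"
  tgt :: "'m \<Rightarrow> 'o"
  idt :: "'o \<Rightarrow> 'm"
  cmp :: "'m \<Rightarrow> 'm \<Rightarrow> 'm"

text \<open>\<open>homs G a b\<close> is the set of morphisms from \<open>b\<close> to \<open>a\<close>: the codomain comes first.\<close>

definition homs :: "('o, 'm, 'x) groupoid_scheme \<Rightarrow> 'o \<Rightarrow> 'o \<Rightarrow> 'm set" where
  "homs G a b = {f \<in> mor G. tgt G f = a \<and> src G f = b}"

definition homs_to :: "('o, 'm, 'x) groupoid_scheme \<Rightarrow> 'o \<Rightarrow> 'm set" where
  "homs_to G a = {f \<in> mor G. tgt G f = a}"

definition is_inverse :: "('o, 'm, 'x) groupoid_scheme \<Rightarrow> 'm \<Rightarrow> 'm \<Rightarrow> bool" where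
  "is_inverse G f g \<longleftrightarrow> g \<in> homs G (src G f) (tgt G f) \<and>
     cmp G f g = idt G (tgt G f) \<and> cmp G g f = idt G (src G f)"

definition ginv :: "('o, 'm, 'x) groupoid_scheme \<Rightarrow> 'm \<Rightarrow> 'm" where
  "ginv G f = (THE g. is_inverse G f g)"

locale groupoid =
  fixes G :: "('o, 'm, 'x) groupoid_scheme"
  assumes src_closed: "f \<in> mor G \<Longrightarrow> src G f \<in> obj G"
    and tgt_closed: "f \<in> mor G \<Longrightarrow> tgt G f \<in> obj G"
    and idt_closed: "a \<in> obj G \<Longrightarrow> idt G a \<in> homs G a a"
    and cmp_closed: "f \<in> homs G a b \<Longrightarrow> g \<in> homs G b c \<Longrightarrow> cmp G f g \<in> homs G a c"
    and cmp_assoc: "f \<in> homs G a b \<Longrightarrow> g \<in> homs G b c \<Longrightarrow> h \<in> homs G c d \<Longrightarrow>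
      cmp G (cmp G f g) h = cmp G f (cmp G g h)"
    and cmp_idt_left: "f \<in> homs G a b \<Longrightarrow> cmp G (idt G a) f = f"
    and cmp_idt_right: "f \<in> homs G a b \<Longrightarrow> cmp G f (idt G b) = f"
    and inverse_exists: "f \<in> mor G \<Longrightarrow> \<exists>g. is_inverse G f g"

definition groupoid_connected :: "('o, 'm, 'x) groupoid_scheme \<Rightarrow> bool" where
  "groupoid_connected G \<longleftrightarrow> obj G \<noteq> {} \<and> (\<forall>a\<in>obj G. \<forall>b\<in>obj G. homs G a b \<noteq> {})"

definition groupoid_simply_connected :: "('o, 'm, 'x) groupoid_scheme \<Rightarrow> bool" where
  "groupoid_simply_connected G \<longleftrightarrow>
     (\<forall>a\<in>obj G. \<forall>b\<in>obj G. \<forall>f\<in>homs G a b. \<forall>g\<in>homs G a b. f = g)"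

text \<open>The subgroupoid generated by \<open>A\<close> (with all objects).\<close>

inductive_set generated_subgroupoid :: "('o, 'm, 'x) groupoid_scheme \<Rightarrow> 'm set \<Rightarrow> 'm set"
  for G and A where
  gen_base: "f \<in> A \<Longrightarrow> f \<in> generated_subgroupoid G A"
| gen_idt: "a \<in> obj G \<Longrightarrow> idt G a \<in> generated_subgroupoid G A"
| gen_cmp: "f \<in> generated_subgroupoid G A \<Longrightarrow> g \<in> generated_subgroupoid G A \<Longrightarrow>
    src G f = tgt G g \<Longrightarrow> cmp G f g \<in> generated_subgroupoid G A"
| gen_inv: "f \<in> generated_subgroupoid G A \<Longrightarrow> ginv G f \<in> generated_subgroupoid G A"

text \<open>\<open>product_of G A fs f\<close>: \<open>f\<close> is the product of the composable list \<open>fs\<close> of elements of \<open>A\<close>,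
  the empty products being the identities.\<close>

inductive product_of :: "('o, 'm, 'x) groupoid_scheme \<Rightarrow> 'm set \<Rightarrow> 'm list \<Rightarrow> 'm \<Rightarrow> bool"
  for G and A where
  product_Nil: "a \<in> obj G \<Longrightarrow> product_of G A [] (idt G a)"
| product_Cons: "f \<in> A \<Longrightarrow> product_of G A gs g \<Longrightarrow> src G f = tgt G g \<Longrightarrow>
    product_of G A (f # gs) (cmp G f g)"


section \<open>Signed groupoid sets\<close>

text \<open>The root sets at distinct objects need not be disjoint as sets, hence negation takes the
  object as an argument; \<open>act R f\<close> maps the roots at \<open>src R f\<close> to those at \<open>tgt R f\<close>.\<close>

record ('o, 'm, 'r) sgset = "('o, 'm) groupoid" +
  roots :: "'o \<Rightarrow> 'r set"
  pos :: "'o \<Rightarrow> 'r set"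
  rneg :: "'o \<Rightarrow> 'r \<Rightarrow> 'r"
  act :: "'m \<Rightarrow> 'r \<Rightarrow> 'r"

definition definitely_involuted_set :: "'r set \<Rightarrow> 'r set \<Rightarrow> ('r \<Rightarrow> 'r) \<Rightarrow> bool" where
  "definitely_involuted_set E P n \<longleftrightarrow>
     (\<forall>x\<in>E. n x \<in> E \<and> n (n x) = x \<and> n x \<noteq> x) \<and>
     P \<subseteq> E \<and> E = P \<union> n ` P \<and> P \<inter> n ` P = {}"

locale signed_groupoid_set = groupoid R
  for R :: "('o, 'm, 'r, 'x) sgset_scheme" +
  assumes involuted: "a \<in> obj R \<Longrightarrow> definitely_involuted_set (roots R a) (pos R a) (rneg R a)"
    and act_closed: "f \<in> homs R a b \<Longrightarrow> x \<in> roots R b \<Longrightarrow> act R f x \<in> roots R a"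
    and act_idt: "a \<in> obj R \<Longrightarrow> x \<in> roots R a \<Longrightarrow> act R (idt R a) x = x"
    and act_cmp: "f \<in> homs R a b \<Longrightarrow> g \<in> homs R b c \<Longrightarrow> x \<in> roots R c \<Longrightarrow>
      act R f (act R g x) = act R (cmp R f g) x"
    and act_neg: "f \<in> homs R a b \<Longrightarrow> x \<in> roots R b \<Longrightarrow>
      act R f (rneg R b x) = rneg R a (act R f x)"

definition negs :: "('o, 'm, 'r, 'x) sgset_scheme \<Rightarrow> 'o \<Rightarrow> 'r set" where
  "negs R a = rneg R a ` pos R a"

definition finite_sgset :: "('o, 'm, 'r, 'x) sgset_scheme \<Rightarrow> bool" where
  "finite_sgset R \<longleftrightarrow> finite (mor R) \<and> (\<forall>a\<in>obj R. finite (roots R a))"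

definition restrict_sgset ::
    "('o, 'm, 'r, 'x) sgset_scheme \<Rightarrow> 'o set \<Rightarrow> ('o, 'm, 'r, 'x) sgset_scheme" where
  "restrict_sgset R C = R\<lparr>obj := C, mor := {f \<in> mor R. tgt R f \<in> C \<and> src R f \<in> C}\<rparr>"

definition connected_component_of ::
    "('o, 'm, 'r, 'x) sgset_scheme \<Rightarrow> ('o, 'm, 'r, 'x) sgset_scheme \<Rightarrow> bool" where
  "connected_component_of S R \<longleftrightarrow>
     (\<exists>a\<in>obj R. S = restrict_sgset R {b \<in> obj R. homs R b a \<noteq> {}})"

text \<open>\<open>inversions R g\<close> is the set $\Phi_g$.\<close>

definition inversions :: "('o, 'm, 'r, 'x) sgset_scheme \<Rightarrow> 'm \<Rightarrow> 'r set" where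
  "inversions R g = {\<alpha> \<in> pos R (tgt R g). act R (ginv R g) \<alpha> \<in> negs R (src R g)}"

definition faithful :: "('o, 'm, 'r, 'x) sgset_scheme \<Rightarrow> bool" where
  "faithful R \<longleftrightarrow> (\<forall>g\<in>mor R. inversions R g = {} \<longrightarrow> (\<exists>a\<in>obj R. g = idt R a))"

definition weak_order :: "('o, 'm, 'r, 'x) sgset_scheme \<Rightarrow> 'o \<Rightarrow> 'm gorder" where
  "weak_order R a =
     \<lparr>carrier = homs_to R a, eq = (=), le = (\<lambda>g h. inversions R g \<subseteq> inversions R h)\<rparr>"

definition complete_sgset :: "('o, 'm, 'r, 'x) sgset_scheme \<Rightarrow> bool" where
  "complete_sgset R \<longleftrightarrow> faithful R \<and> (\<forall>a\<in>obj R. complete_lattice (weak_order R a))"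

definition is_atom :: "('a, 'y) gorder_scheme \<Rightarrow> 'a \<Rightarrow> bool" where
  "is_atom L x \<longleftrightarrow> x \<in> carrier L \<and> \<not> least L x (carrier L) \<and>
     (\<forall>y\<in>carrier L. y \<sqsubseteq>\<^bsub>L\<^esub> x \<longrightarrow> least L y (carrier L) \<or> y = x)"

definition atomic :: "('o, 'm, 'r, 'x) sgset_scheme \<Rightarrow> 'm \<Rightarrow> bool" where
  "atomic R g \<longleftrightarrow> g \<in> mor R \<and> is_atom (weak_order R (tgt R g)) g"

definition simple_mor :: "('o, 'm, 'r, 'x) sgset_scheme \<Rightarrow> 'm \<Rightarrow> bool" where
  "simple_mor R g \<longleftrightarrow> g \<in> mor R \<and> card (inversions R g) = 1"

definition interval_finite :: "('o, 'm, 'r, 'x) sgset_scheme \<Rightarrow> bool" where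
  "interval_finite R \<longleftrightarrow>
     (\<forall>a\<in>obj R. \<forall>g\<in>homs_to R a. finite {h \<in> homs_to R a. h \<sqsubseteq>\<^bsub>weak_order R a\<^esub> g})"

definition preprincipal :: "('o, 'm, 'r, 'x) sgset_scheme \<Rightarrow> bool" where
  "preprincipal R \<longleftrightarrow> faithful R \<and> interval_finite R \<and>
     (\<forall>a\<in>obj R. \<forall>g\<in>homs_to R a. \<forall>s\<in>homs_to R a. atomic R s \<longrightarrow>
        inversions R s \<subseteq> inversions R g \<or> inversions R s \<inter> inversions R g = {})"

text \<open>Finiteness of the inversion sets is explicit because \<open>card\<close> is \<open>0\<close> on infinite sets.\<close>

definition principal_sgset :: "('o, 'm, 'r, 'x) sgset_scheme \<Rightarrow> bool" where
  "principal_sgset R \<longleftrightarrow>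
     generated_subgroupoid R (Collect (simple_mor R)) = mor R \<and>
     (\<forall>g\<in>mor R. finite (inversions R g) \<and>
        (\<exists>fs. product_of R (Collect (simple_mor R)) fs g \<and> length fs = card (inversions R g)) \<and>
        (\<forall>fs. product_of R (Collect (simple_mor R)) fs g \<longrightarrow> card (inversions R g) \<le> length fs))"


section \<open>Real compression\<close>

definition imaginary :: "('o, 'm, 'r, 'x) sgset_scheme \<Rightarrow> 'o \<Rightarrow> 'r \<Rightarrow> bool" where
  "imaginary R a \<alpha> \<longleftrightarrow>
     (\<exists>\<beta>\<in>pos R a. (\<forall>g\<in>homs_to R a. \<beta> \<notin> inversions R g) \<and> (\<alpha> = \<beta> \<or> \<alpha> = rneg R a \<beta>))"

definition real_roots :: "('o, 'm, 'r, 'x) sgset_scheme \<Rightarrow> 'o \<Rightarrow> 'r set" where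
  "real_roots R a = {\<alpha> \<in> roots R a. \<not> imaginary R a \<alpha>}"

definition real_sgset :: "('o, 'm, 'r, 'x) sgset_scheme \<Rightarrow> bool" where
  "real_sgset R \<longleftrightarrow> (\<forall>a\<in>obj R. \<forall>\<alpha>\<in>roots R a. \<not> imaginary R a \<alpha>)"

definition parallel :: "('o, 'm, 'r, 'x) sgset_scheme \<Rightarrow> 'o \<Rightarrow> ('r \<times> 'r) set" where
  "parallel R a = {(\<alpha>, \<beta>). \<alpha> \<in> roots R a \<and> \<beta> \<in> roots R a \<and>
     (\<forall>g\<in>homs_to R a. act R (ginv R g) \<alpha> \<in> pos R (src R g) \<longleftrightarrow>
                       act R (ginv R g) \<beta> \<in> pos R (src R g))}"

definition real_compression :: "('o, 'm, 'r) sgset \<Rightarrow> ('o, 'm, 'r set) sgset" where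
  "real_compression R =
     \<lparr>obj = obj R, mor = mor R, src = src R, tgt = tgt R, idt = idt R, cmp = cmp R,
      roots = (\<lambda>a. real_roots R a // parallel R a),
      pos = (\<lambda>a. (real_roots R a \<inter> pos R a) // parallel R a),
      rneg = (\<lambda>a C. \<Union>\<alpha>\<in>C. parallel R a `` {rneg R a \<alpha>}),
      act = (\<lambda>g C. \<Union>\<alpha>\<in>C. parallel R (tgt R g) `` {act R g \<alpha>})\<rparr>"


section \<open>Squares and the signed groupoid set \<open>R\<^sup>\<box>\<close>\<close>

definition is_square :: "('o, 'm, 'r, 'x) sgset_scheme \<Rightarrow> 'm \<Rightarrow> 'm \<Rightarrow> 'm \<Rightarrow> 'm \<Rightarrow> bool" where
  "is_square R x w y z \<longleftrightarrow>
     (\<exists>a\<in>obj R. \<exists>b\<in>obj R. \<exists>c\<in>obj R. \<exists>d\<in>obj R.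
        w \<in> homs R b a \<and> x \<in> homs R d b \<and> z \<in> homs R c a \<and> y \<in> homs R d c) \<and>
     cmp R x w = cmp R y z \<and> act R x ` inversions R w = inversions R y"

text \<open>\<open>box_mor R f a X b Y\<close>: \<open>f\<close> is a morphism from \<open>(a, X)\<close> to \<open>(b, Y)\<close>.\<close>

definition box_mor ::
    "('o, 'm, 'r, 'x) sgset_scheme \<Rightarrow> 'm \<Rightarrow> 'o \<Rightarrow> 'm set \<Rightarrow> 'o \<Rightarrow> 'm set \<Rightarrow> bool" where
  "box_mor R f a X b Y \<longleftrightarrow> f \<in> homs R b a \<and>
     (\<exists>\<sigma>. bij_betw \<sigma> X Y \<and>
        (\<forall>g\<in>X. is_square R f g (\<sigma> g) (cmp R (ginv R (\<sigma> g)) (cmp R f g))))"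

text \<open>The same \<open>f\<close> may be a morphism between several pairs of objects, so a morphism is
  represented as a triple (codomain, \<open>f\<close>, domain).\<close>

definition box_sgset :: "('o, 'm, 'r) sgset \<Rightarrow>
    ('o \<times> 'm set, ('o \<times> 'm set) \<times> 'm \<times> ('o \<times> 'm set), 'r) sgset" where
  "box_sgset R =
     (let O' = {(a, X). a \<in> obj R \<and> X \<subseteq> homs_to R a} in
     \<lparr>obj = O',
      mor = {((b, Y), f, (a, X)) | a X b Y f. (a, X) \<in> O' \<and> (b, Y) \<in> O' \<and> box_mor R f a X b Y},
      src = (\<lambda>(q, f, p). p),
      tgt = (\<lambda>(q, f, p). q),
      idt = (\<lambda>p. (p, idt R (fst p), p)),
      cmp = (\<lambda>(r, f, q) (q', g, p). (r, cmp R f g, p)),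
      roots = (\<lambda>p. roots R (fst p)),
      pos = (\<lambda>p. pos R (fst p)),
      rneg = (\<lambda>p. rneg R (fst p)),
      act = (\<lambda>(q, f, p). act R f)\<rparr>)"

end

theory Submission
  imports Defs
begin

text \<open>Over a connected, simply connected groupoid all roots can be transported to one base object;
  an object \<open>a\<close> then becomes a set of roots, its chamber (the roots that are positive at \<open>a\<close>), and
  $\Phi_g$, for \<open>g\<close> from \<open>b\<close> to \<open>a\<close>, becomes the difference of the chambers of \<open>a\<close> and \<open>b\<close>.
  Weak orders compare the symmetric differences of chambers. A morphism of $G^\Box$ preserves the
  set of differences determined by \<open>X\<close>, so a component of $R^\Box$ consists of the chambers
  admitting a fixed set of shifts by differences. Such chambers are closed under joins, because
  $\Phi_x \cap \Phi_g = \emptyset$ means that \<open>a\<close> lies below \<open>g\<close> in the weak order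
  based at \<open>x\<close>. An atom \<open>s\<close> of a component is obtained from any atom \<open>r \<le> s\<close> of \<open>R\<close> by steps
  of a closure procedure built from joins; each step preserves both being below a given \<open>g\<close> and
  being orthogonal to \<open>g\<close>, so the preprincipal dichotomy passes from \<open>r\<close> to \<open>s\<close>. Real
  compression does not change the weak orders, and by preprincipality all roots in $\Phi_s$ are
  parallel when \<open>s\<close> is an atom, so that atomic morphisms become simple.\<close>

section \<open>Families of chambers\<close>

definition sep :: "'e set \<Rightarrow> 'e set \<Rightarrow> 'e set" where
  "sep A B = (A - B) \<union> (B - A)"

lemma in_sep: "e \<in> sep A B \<longleftrightarrow> (e \<in> A) \<noteq> (e \<in> B)"
  by (auto simp: sep_def)

lemma sep_empty_iff: "sep A B = {} \<longleftrightarrow> A = B"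
  by (auto simp: sep_def)

lemma sep_left_cancel: "sep A B = sep A C \<longleftrightarrow> B = C"
  by (auto simp: set_eq_iff in_sep)

text \<open>A base A orders the family by inclusion of the sets \<open>sep A B\<close>, with A
  itself at the bottom when it belongs to the family. J is a least upper bound for this
  order.\<close>

definition is_join :: "'e set set \<Rightarrow> 'e set \<Rightarrow> 'e set set \<Rightarrow> 'e set \<Rightarrow> bool" where
  "is_join \<K> A \<A> J \<longleftrightarrow> J \<in> \<K> \<and> (\<forall>B\<in>\<A>. sep A B \<subseteq> sep A J) \<and>
     (\<forall>U\<in>\<K>. (\<forall>B\<in>\<A>. sep A B \<subseteq> sep A U) \<longrightarrow> sep A J \<subseteq> sep A U)"

text \<open>Asking for joins at every base is enough: meets are recovered later as joins of sets of
  lower bounds.\<close>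

definition complete_family :: "'e set set \<Rightarrow> bool" where
  "complete_family \<K> \<longleftrightarrow> (\<forall>A\<in>\<K>. \<forall>\<A>\<subseteq>\<K>. \<exists>J. is_join \<K> A \<A> J)"

text \<open>The atoms of the order based at A, whose least element is A.\<close>

definition adjacent :: "'e set set \<Rightarrow> 'e set \<Rightarrow> 'e set \<Rightarrow> bool" where
  "adjacent \<K> A B \<longleftrightarrow> B \<in> \<K> \<and> B \<noteq> A \<and> (\<forall>C\<in>\<K>. sep A C \<subseteq> sep A B \<longrightarrow> C = A \<or> C = B)"

definition preprincipal_family :: "'e set set \<Rightarrow> bool" where
  "preprincipal_family \<K> \<longleftrightarrow> (\<forall>A\<in>\<K>. \<forall>B\<in>\<K>. \<forall>C\<in>\<K>. adjacent \<K> A B \<longrightarrow>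
     sep A B \<subseteq> sep A C \<or> sep A B \<inter> sep A C = {})"

text \<open>Both halves of a difference are recorded because an abstract family of sets has no
  negation. In the application D' consists of the negatives of the roots in D, and D comes from a
  morphism in the set X of an object (a, X) of the box groupoid.\<close>

definition shiftable :: "'e set set \<Rightarrow> ('e set \<times> 'e set) set \<Rightarrow> 'e set set" where
  "shiftable \<K> \<D> = {B \<in> \<K>. \<forall>(D, D')\<in>\<D>. \<exists>Y\<in>\<K>. B - Y = D \<and> Y - B = D'}"

section \<open>Joins under change of base\<close>

lemma shiftableD:
  assumes "B \<in> shiftable \<K> \<D>"
  shows "B \<in> \<K>" "(D, D') \<in> \<D> \<Longrightarrow> \<exists>Y\<in>\<K>. B - Y = D \<and> Y - B = D'"
  using assms unfolding shiftable_def by auto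

lemma shiftableI:
  assumes "B \<in> \<K>" "\<And>D D'. (D, D') \<in> \<D> \<Longrightarrow> \<exists>Y\<in>\<K>. B - Y = D \<and> Y - B = D'"
  shows "B \<in> shiftable \<K> \<D>"
  using assms unfolding shiftable_def by auto

lemma is_joinD:
  assumes "is_join \<K> A \<A> J"
  shows "J \<in> \<K>" "\<And>B. B \<in> \<A> \<Longrightarrow> sep A B \<subseteq> sep A J"
    "\<And>U. U \<in> \<K> \<Longrightarrow> (\<And>B. B \<in> \<A> \<Longrightarrow> sep A B \<subseteq> sep A U) \<Longrightarrow> sep A J \<subseteq> sep A U"
  using assms unfolding is_join_def by blast+

text \<open>Disjointness of \<open>sep A X\<close> and \<open>sep A B\<close> says that \<open>A\<close> lies below \<open>B\<close> in the order based at
  \<open>X\<close>, and upper sets are closed under joins.\<close>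

lemma join_orthogonal:
  assumes comp: "complete_family \<K>" and A: "A \<in> \<K>" and X: "X \<in> \<K>" and sub: "\<A> \<subseteq> \<K>"
    and J: "is_join \<K> A \<A> J" and disj: "\<And>B. B \<in> \<A> \<Longrightarrow> sep A X \<inter> sep A B = {}"
  shows "sep A X \<inter> sep A J = {}"
proof -
  \<comment> \<open>M bounds all B at base X and also lies above A there. As A is between X and each
    B, M is an upper bound of the B at base A too, so J lies below M at base A; and A is between X
    and M.\<close>
  obtain M where M: "is_join \<K> X (insert A \<A>) M"
    using comp A X sub unfolding complete_family_def by (meson insert_subset)
  have XA: "sep X A \<subseteq> sep X M" using is_joinD(2)[OF M] by blast
  have "sep A B \<subseteq> sep A M" if B: "B \<in> \<A>" for B
  proof -
    have "sep X B \<subseteq> sep X M" using is_joinD(2)[OF M] B by blast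
    then show ?thesis using disj[OF B] by (auto simp: in_sep set_eq_iff subset_iff)
  qed
  then have "sep A J \<subseteq> sep A M" using is_joinD(1)[OF M] is_joinD(3)[OF J] by blast
  then show ?thesis using XA by (auto simp: in_sep set_eq_iff subset_iff)
qed

text \<open>Each \<open>sep A B\<close> lies in \<open>sep X J'\<close> and avoids
  \<open>sep A X\<close>. Outside \<open>sep A X\<close> the bases A and X agree, so J' bounds the B
  at base A as well and J lies below it. Orthogonality of J to X then brings the inclusion back to
  base X.\<close>

lemma join_shift_subset:
  assumes comp: "complete_family \<K>" and A: "A \<in> \<K>" and X: "X \<in> \<K>"
    and sub: "\<A> \<subseteq> \<K>" "\<A>' \<subseteq> \<K>" and J: "is_join \<K> A \<A> J" and J': "is_join \<K> X \<A>' J'"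
    and disj: "\<And>B. B \<in> \<A> \<Longrightarrow> sep A X \<inter> sep A B = {}"
    and img: "sep A ` \<A> = sep X ` \<A>'"
  shows "sep A J \<subseteq> sep X J'"
proof -
  have jo: "sep A X \<inter> sep A J = {}"
    using join_orthogonal[OF comp A X sub(1) J] disj by blast
  have "sep A B \<subseteq> sep A J'" if B: "B \<in> \<A>" for B
  proof -
    obtain B' where "B' \<in> \<A>'" "sep A B = sep X B'" using img B by blast
    then have "sep A B \<subseteq> sep X J'" using is_joinD(2)[OF J'] by blast
    then show ?thesis using disj[OF B] by (auto simp: in_sep set_eq_iff subset_iff)
  qed
  then have "sep A J \<subseteq> sep A J'" using is_joinD(1)[OF J'] is_joinD(3)[OF J] by blast
  then show ?thesis using jo by (auto simp: in_sep set_eq_iff subset_iff)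
qed

lemma sep_commute: "sep A B = sep B A"
  by (auto simp: sep_def)

text \<open>The hypotheses are symmetric in the two bases, since \<open>img\<close> carries the
  disjointness from one side to the other. Hence the inclusion applies in both directions.\<close>

lemma join_shift:
  assumes comp: "complete_family \<K>" and A: "A \<in> \<K>" and X: "X \<in> \<K>"
    and sub: "\<A> \<subseteq> \<K>" "\<A>' \<subseteq> \<K>" and J: "is_join \<K> A \<A> J" and J': "is_join \<K> X \<A>' J'"
    and disj: "\<And>B. B \<in> \<A> \<Longrightarrow> sep A X \<inter> sep A B = {}"
    and img: "sep A ` \<A> = sep X ` \<A>'"
  shows "sep A J = sep X J'"
proof
  show "sep A J \<subseteq> sep X J'" by (rule join_shift_subset[OF assms])
  have "sep X A \<inter> sep X B' = {}" if B': "B' \<in> \<A>'" for B'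
  proof -
    obtain B where "B \<in> \<A>" "sep X B' = sep A B" using img B' by blast
    then show ?thesis using disj[of B] by (simp add: sep_commute[of X A])
  qed
  then show "sep X J' \<subseteq> sep A J"
    using join_shift_subset[OF comp X A sub(2,1) J' J _ img[symmetric]] by blast
qed

text \<open>The shift of J is the join, based at the shift X of A, of the shifts of the members of
  the subfamily.\<close>

lemma shiftable_join:
  assumes comp: "complete_family \<K>" and A: "A \<in> shiftable \<K> \<D>" and sub: "\<A> \<subseteq> shiftable \<K> \<D>"
    and J: "is_join \<K> A \<A> J"
  shows "J \<in> shiftable \<K> \<D>"
proof -
  have AK: "A \<in> \<K>" and subK: "\<A> \<subseteq> \<K>" using A sub unfolding shiftable_def by auto
  have "\<exists>Y\<in>\<K>. J - Y = D \<and> Y - J = D'" if D: "(D, D') \<in> \<D>" for D D'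
  proof -
    obtain X where X: "X \<in> \<K>" "A - X = D" "X - A = D'" using shiftableD(2)[OF A D] by blast
    have "\<forall>B\<in>\<A>. \<exists>Y\<in>\<K>. B - Y = D \<and> Y - B = D'"
      using sub shiftableD(2)[OF _ D] by blast
    then obtain f where "\<forall>B\<in>\<A>. f B \<in> \<K> \<and> B - f B = D \<and> f B - B = D'"
      unfolding bchoice_iff Bex_def by blast
    then have f: "\<And>B. B \<in> \<A> \<Longrightarrow> f B \<in> \<K> \<and> B - f B = D \<and> f B - B = D'" by blast
    have disj: "sep A X \<inter> sep A B = {}" and eq: "sep X (f B) = sep A B" if "B \<in> \<A>" for B
      using f[OF that] X by (auto simp: in_sep set_eq_iff)
    have sub': "f ` \<A> \<subseteq> \<K>" using f by blast
    then obtain J' where J': "is_join \<K> X (f ` \<A>) J'"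
      using comp X(1) unfolding complete_family_def by blast
    have img: "sep A ` \<A> = sep X ` f ` \<A>" using eq by (force simp: image_iff)
    have e: "sep A J = sep X J'" by (rule join_shift[OF comp AK X(1) subK sub' J J' disj img])
    have o: "sep A X \<inter> sep A J = {}" by (rule join_orthogonal[OF comp AK X(1) subK J disj])
    \<comment> \<open>On \<open>sep A X\<close>, J agrees with A and J' agrees with X, by
      \<open>o\<close>. Elsewhere A and X agree, so J and J' agree by \<open>e\<close>.\<close>
    have "J - J' = D" "J' - J = D'" using e o X by (auto simp: in_sep set_eq_iff)
    then show ?thesis using is_joinD(1)[OF J'] by blast
  qed
  then show ?thesis using is_joinD(1)[OF J] by (intro shiftableI)
qed

text \<open>The join formed in the large family is already shiftable, and it remains least among
  fewer upper bounds.\<close>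

theorem complete_family_shiftable:
  assumes "complete_family \<K>"
  shows "complete_family (shiftable \<K> \<D>)"
  unfolding complete_family_def
proof (intro ballI allI impI)
  fix A \<A> assume A: "A \<in> shiftable \<K> \<D>" and sub: "\<A> \<subseteq> shiftable \<K> \<D>"
  have subK: "shiftable \<K> \<D> \<subseteq> \<K>" unfolding shiftable_def by blast
  then obtain J where J: "is_join \<K> A \<A> J"
    using assms A sub unfolding complete_family_def by (meson subset_iff subset_trans)
  then have "is_join (shiftable \<K> \<D>) A \<A> J"
    using shiftable_join[OF assms A sub J] subK unfolding is_join_def by blast
  then show "\<exists>J. is_join (shiftable \<K> \<D>) A \<A> J" by blast
qed

text \<open>The element \<open>Z'\<close> is the join, in the order based at \<open>X\<close>, of \<open>A\<close> with the join of \<open>X\<close> and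
  \<open>Z\<close> in the order based at \<open>A\<close>.\<close>

lemma shift_closure_step:
  assumes comp: "complete_family \<K>" and A: "A \<in> \<K>" and Z: "Z \<in> \<K>" and X: "X \<in> \<K>"
    and disj: "sep A X \<inter> sep A Z = {}"
  obtains Z' where "Z' \<in> \<K>" "sep A Z \<subseteq> sep A Z'"
    and "\<And>C Y. C \<in> \<K> \<Longrightarrow> Y \<in> \<K> \<Longrightarrow> C - Y = A - X \<Longrightarrow> Y - C = X - A \<Longrightarrow>
       sep A Z \<subseteq> sep A C \<Longrightarrow> sep A Z' \<subseteq> sep A C"
    and "\<And>C Y. C \<in> \<K> \<Longrightarrow> Y \<in> \<K> \<Longrightarrow> C - Y = A - X \<Longrightarrow> Y - C = X - A \<Longrightarrow>
       sep A Z \<inter> sep A C = {} \<Longrightarrow> sep A Z' \<inter> sep A C = {}"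
    and "Z' = Z \<Longrightarrow> \<exists>Y\<in>\<K>. Z - Y = A - X \<and> Y - Z = X - A"
proof -
  obtain W where W: "is_join \<K> A {X, Z} W"
    using comp A X Z unfolding complete_family_def by (meson empty_subsetI insert_subset)
  note WK = is_joinD(1)[OF W]
  obtain Z' where Z': "is_join \<K> X {A, W} Z'"
    using comp A X WK unfolding complete_family_def by (meson empty_subsetI insert_subset)
  note Z'K = is_joinD(1)[OF Z']
  have wx: "sep A X \<subseteq> sep A W" and wz: "sep A Z \<subseteq> sep A W" using is_joinD(2)[OF W] by auto
  have za: "sep X A \<subseteq> sep X Z'" and zw: "sep X W \<subseteq> sep X Z'" using is_joinD(2)[OF Z'] by auto
  show thesis
  proof
    show "Z' \<in> \<K>" by (rule Z'K)
    show "sep A Z \<subseteq> sep A Z'"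
      using wx wz za zw disj by (auto simp: in_sep set_eq_iff subset_iff)
  next
    fix C Y assume C: "C \<in> \<K>" "Y \<in> \<K>" and CY: "C - Y = A - X" "Y - C = X - A"
      and le: "sep A Z \<subseteq> sep A C"
    \<comment> \<open>C and its shift Y differ exactly where A and X do. So X and Z, hence also W,
      lie below Y at base A. Shifting the comparison of W with Y to base X puts A and W below C
      there.\<close>
    have "sep A X \<subseteq> sep A Y" "sep A Z \<subseteq> sep A Y"
      using le CY disj by (auto simp: in_sep set_eq_iff subset_iff)
    then have "sep A W \<subseteq> sep A Y" using is_joinD(3)[OF W C(2)] by blast
    then have "sep X A \<subseteq> sep X C" "sep X W \<subseteq> sep X C"
      using CY wx by (auto simp: in_sep set_eq_iff subset_iff)
    then have "sep X Z' \<subseteq> sep X C" using is_joinD(3)[OF Z' C(1)] by blast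
    then show "sep A Z' \<subseteq> sep A C"
      using CY za by (auto simp: in_sep set_eq_iff subset_iff)
  next
    fix C Y assume C: "C \<in> \<K>" "Y \<in> \<K>" and CY: "C - Y = A - X" "Y - C = X - A"
      and o: "sep A Z \<inter> sep A C = {}"
    \<comment> \<open>C agrees with A on \<open>sep A X\<close>, so it is orthogonal to both X and
      Z, hence to their join W. At base X the same argument is run with Y in place of C, because
      \<open>sep X Y\<close> equals \<open>sep A C\<close>.\<close>
    have "sep A C \<inter> sep A X = {}" using CY by (auto simp: in_sep set_eq_iff)
    then have cw: "sep A C \<inter> sep A W = {}"
      using join_orthogonal[OF comp A C(1) _ W] X Z o by (auto simp: Int_commute)
    have "sep X Y \<inter> sep X A = {}" "sep X Y \<inter> sep X W = {}"
      using CY cw by (auto simp: in_sep set_eq_iff)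
    then have "sep X Y \<inter> sep X Z' = {}"
      using join_orthogonal[OF comp X C(2) _ Z'] A WK by auto
    then show "sep A Z' \<inter> sep A C = {}"
      using CY za by (auto simp: in_sep set_eq_iff subset_iff)
  next
    assume "Z' = Z"
    \<comment> \<open>At a fixed point the required shift of Z is W itself: \<open>sep A W\<close>
      is then the disjoint union of \<open>sep A X\<close> and \<open>sep A Z\<close>. The equality
      is checked element by element.\<close>
    have "(e \<in> Z \<and> e \<notin> W \<longleftrightarrow> e \<in> A \<and> e \<notin> X) \<and> (e \<in> W \<and> e \<notin> Z \<longleftrightarrow> e \<in> X \<and> e \<notin> A)" for e
      using subsetD[OF za, of e] subsetD[OF zw, of e] subsetD[OF wx, of e] subsetD[OF wz, of e]
        disjoint_iff[THEN iffD1, OF disj, rule_format, of e] \<open>Z' = Z\<close>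
      unfolding in_sep
      by (cases "e \<in> A"; cases "e \<in> X"; cases "e \<in> Z"; cases "e \<in> W"; simp)
    then have "Z - W = A - X \<and> W - Z = X - A" by blast
    then show "\<exists>Y\<in>\<K>. Z - Y = A - X \<and> Y - Z = X - A" using WK by blast
  qed
qed

section \<open>Atoms of a shiftable subfamily\<close>

lemma adjacent_below:
  assumes fin: "finite \<K>" and "B \<in> \<K>" "B \<noteq> A"
  obtains C where "adjacent \<K> A C" "sep A C \<subseteq> sep A B"
proof -
  \<comment> \<open>Minimality is taken among the sets \<open>sep A C\<close>, where the based order
    is plain inclusion; \<open>sep_left_cancel\<close> recovers C.\<close>
  define F where "F = sep A ` {C \<in> \<K>. C \<noteq> A \<and> sep A C \<subseteq> sep A B}"
  have "finite F" "F \<noteq> {}" using assms unfolding F_def by auto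
  from finite_has_minimal[OF this]
  obtain m where m: "m \<in> F" "\<And>d. d \<in> F \<Longrightarrow> d \<subseteq> m \<Longrightarrow> m = d" by metis
  then obtain C where C: "C \<in> \<K>" "C \<noteq> A" "sep A C \<subseteq> sep A B" "m = sep A C"
    unfolding F_def by blast
  have "adjacent \<K> A C" unfolding adjacent_def
  proof (intro conjI ballI impI)
    fix E assume "E \<in> \<K>" "sep A E \<subseteq> sep A C"
    then have "E \<noteq> A \<Longrightarrow> sep A C = sep A E" using m(2)[of "sep A E"] C unfolding F_def by blast
    then show "E = A \<or> E = C" using sep_left_cancel by metis
  qed (use C in auto)
  then show thesis using that C by blast
qed

text \<open>Instead of iterating the closure step from an atom C below S, a maximal Z between C and
  S is chosen among those that keep the relation of C to G. Every closure step then leaves Z fixed,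
  so Z is shiftable, and Z must be S because S is an atom of the subfamily.\<close>

theorem preprincipal_family_shiftable:
  assumes fin: "finite \<K>" and comp: "complete_family \<K>" and pre: "preprincipal_family \<K>"
  shows "preprincipal_family (shiftable \<K> \<D>)"
  unfolding preprincipal_family_def
proof (intro ballI impI)
  fix A S G assume A: "A \<in> shiftable \<K> \<D>" and S: "S \<in> shiftable \<K> \<D>" and G: "G \<in> shiftable \<K> \<D>"
    and adj: "adjacent (shiftable \<K> \<D>) A S"
  have K: "A \<in> \<K>" "S \<in> \<K>" "G \<in> \<K>" using shiftableD(1) A S G by blast+
  have SA: "S \<noteq> A" using adj unfolding adjacent_def by blast
  obtain C where C: "adjacent \<K> A C" "sep A C \<subseteq> sep A S"
    by (rule adjacent_below[OF fin K(2) SA])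
  then have CK: "C \<in> \<K>" "C \<noteq> A" unfolding adjacent_def by auto
  \<comment> \<open>P keeps whichever side of the dichotomy C satisfies against G: lying below G or
    being orthogonal to it. The closure step preserves both.\<close>
  define P where "P Z \<longleftrightarrow> (if sep A C \<subseteq> sep A G then sep A Z \<subseteq> sep A G else sep A Z \<inter> sep A G = {})" for Z
  have PC: "P C" using pre C(1) CK K unfolding P_def preprincipal_family_def by auto
  define F where "F = {Z \<in> \<K>. sep A C \<subseteq> sep A Z \<and> sep A Z \<subseteq> sep A S \<and> P Z}"
  have "finite (sep A ` F)" "sep A ` F \<noteq> {}" using fin CK PC C unfolding F_def by auto
  from finite_has_maximal[OF this]
  obtain m where m: "m \<in> sep A ` F" "\<And>d. d \<in> sep A ` F \<Longrightarrow> m \<subseteq> d \<Longrightarrow> m = d" by metis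
  then obtain Z where "Z \<in> F" and mZ: "m = sep A Z" by blast
  then have Z: "Z \<in> \<K>" "sep A C \<subseteq> sep A Z" "sep A Z \<subseteq> sep A S" "P Z" unfolding F_def by auto
  have "\<exists>Y\<in>\<K>. Z - Y = D \<and> Y - Z = D'" if D: "(D, D') \<in> \<D>" for D D'
  proof -
    obtain X where X: "X \<in> \<K>" "A - X = D" "X - A = D'" using shiftableD(2)[OF A D] by blast
    obtain YS where YS: "YS \<in> \<K>" "S - YS = A - X" "YS - S = X - A"
      using shiftableD(2)[OF S D] X by blast
    obtain YG where YG: "YG \<in> \<K>" "G - YG = A - X" "YG - G = X - A"
      using shiftableD(2)[OF G D] X by blast
    \<comment> \<open>S admits the same shift as A, so it agrees with A on \<open>sep A X\<close>;
      anything below S at base A does so too.\<close>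
    have disj: "sep A X \<inter> sep A Z = {}"
      using Z(3) YS by (auto simp: in_sep set_eq_iff subset_iff)
    obtain Z' where Z': "Z' \<in> \<K>" "sep A Z \<subseteq> sep A Z'"
      and le: "\<And>C Y. C \<in> \<K> \<Longrightarrow> Y \<in> \<K> \<Longrightarrow> C - Y = A - X \<Longrightarrow> Y - C = X - A \<Longrightarrow>
       sep A Z \<subseteq> sep A C \<Longrightarrow> sep A Z' \<subseteq> sep A C"
      and o: "\<And>C Y. C \<in> \<K> \<Longrightarrow> Y \<in> \<K> \<Longrightarrow> C - Y = A - X \<Longrightarrow> Y - C = X - A \<Longrightarrow>
       sep A Z \<inter> sep A C = {} \<Longrightarrow> sep A Z' \<inter> sep A C = {}"
      and fixp: "Z' = Z \<Longrightarrow> \<exists>Y\<in>\<K>. Z - Y = A - X \<and> Y - Z = X - A"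
      by (rule shift_closure_step[OF comp K(1) Z(1) X(1) disj]) iprover
    have "sep A Z' \<subseteq> sep A S" using le[OF K(2) YS Z(3)] .
    moreover have "P Z'" using Z(4) le[OF K(3) YG] o[OF K(3) YG] unfolding P_def by auto
    ultimately have "Z' \<in> F" using Z' Z(2) unfolding F_def by blast
    then have "sep A Z = sep A Z'" using m(2) mZ Z'(2) by (metis imageI)
    then have "Z' = Z" using sep_left_cancel by metis
    then show ?thesis using fixp X by blast
  qed
  then have "Z \<in> shiftable \<K> \<D>" using Z(1) by (intro shiftableI)
  moreover have "Z \<noteq> A" using Z(2) CK(2) by (metis sep_empty_iff subset_empty)
  ultimately have "Z = S" using adj Z(3) unfolding adjacent_def by blast
  then show "sep A S \<subseteq> sep A G \<or> sep A S \<inter> sep A G = {}"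
    using Z(4) unfolding P_def by (auto split: if_splits)
qed

section \<open>Signed groupoid sets over connected, simply connected groupoids\<close>

lemma definitely_involutedD:
  assumes "definitely_involuted_set E P n"
  shows "P \<subseteq> E" "x \<in> E \<Longrightarrow> n x \<in> E" "x \<in> E \<Longrightarrow> n (n x) = x"
    "x \<in> E \<Longrightarrow> n x \<in> P \<longleftrightarrow> x \<notin> P" "x \<in> n ` P \<longleftrightarrow> x \<in> E \<and> x \<notin> P"
proof -
  have E: "\<And>x. x \<in> E \<Longrightarrow> n x \<in> E \<and> n (n x) = x \<and> n x \<noteq> x" and P: "P \<subseteq> E" "E = P \<union> n ` P" "P \<inter> n ` P = {}"
    using assms unfolding definitely_involuted_set_def by auto
  show "P \<subseteq> E" "x \<in> E \<Longrightarrow> n x \<in> E" "x \<in> E \<Longrightarrow> n (n x) = x" using E P by auto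
  show in_neg: "x \<in> n ` P \<longleftrightarrow> x \<in> E \<and> x \<notin> P" for x using P by blast
  show "n x \<in> P \<longleftrightarrow> x \<notin> P" if x: "x \<in> E"
  proof
    assume "n x \<in> P"
    then have "n (n x) \<in> n ` P" by (rule imageI)
    then show "x \<notin> P" using in_neg[of x] E[OF x] by simp
  next
    assume "x \<notin> P"
    then obtain p where "p \<in> P" "x = n p" using in_neg[of x] x by blast
    then show "n x \<in> P" using E[of p] P(1) by auto
  qed
qed

lemma inj_on_image_subset_iff:
  assumes "inj_on f C" "A \<subseteq> C" "B \<subseteq> C"
  shows "f ` A \<subseteq> f ` B \<longleftrightarrow> A \<subseteq> B"
proof
  assume "f ` A \<subseteq> f ` B"
  then show "A \<subseteq> B" using inj_on_image_mem_iff[OF assms(1) _ assms(3)] assms(2) by blast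
qed blast

text \<open>Every ordered pair of objects has exactly one morphism, so a morphism is determined by
  its endpoints. The object \<open>base\<close> is where all roots are compared.\<close>

locale indiscrete_sgset = signed_groupoid_set R for R :: "('o, 'm, 'r) sgset" +
  fixes base :: 'o
  assumes connected: "groupoid_connected R"
    and simply_connected: "groupoid_simply_connected R"
    and base: "base \<in> obj R"
begin

definition arr :: "'o \<Rightarrow> 'o \<Rightarrow> 'm" where
  "arr a b = (THE f. f \<in> homs R a b)"

lemma homs_objD:
  assumes "f \<in> homs R a b"
  shows "a \<in> obj R" "b \<in> obj R"
  using assms src_closed tgt_closed unfolding homs_def by auto

lemma homs_unique:
  assumes "f \<in> homs R a b" "g \<in> homs R a b"
  shows "f = g"
  using assms homs_objD[OF assms(1)] simply_connected unfolding groupoid_simply_connected_def by blast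

lemma arr_eqI:
  assumes "f \<in> homs R a b"
  shows "f = arr a b"
  unfolding arr_def by (rule the_equality[symmetric]) (use assms homs_unique in auto)

lemma arr_homs:
  assumes "a \<in> obj R" "b \<in> obj R"
  shows "arr a b \<in> homs R a b"
proof -
  obtain f where "f \<in> homs R a b" using connected assms unfolding groupoid_connected_def by blast
  then show ?thesis using arr_eqI by metis
qed

lemma arr_simps [simp]:
  assumes "a \<in> obj R" "b \<in> obj R"
  shows "arr a b \<in> mor R" "tgt R (arr a b) = a" "src R (arr a b) = b"
  using arr_homs[OF assms] unfolding homs_def by auto

lemma arr_eq_iff:
  assumes "a \<in> obj R" "b \<in> obj R" "c \<in> obj R"
  shows "arr a b = arr a c \<longleftrightarrow> b = c"
  using assms arr_simps(3) by metis

lemma mor_arrE: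
  assumes "f \<in> mor R"
  obtains a b where "a \<in> obj R" "b \<in> obj R" "f = arr a b"
  using assms arr_eqI[of f "tgt R f" "src R f"] src_closed tgt_closed unfolding homs_def by blast

text \<open>This turns the weak order at a into an order on the objects themselves.\<close>

lemma homs_to_eq:
  assumes "a \<in> obj R"
  shows "homs_to R a = arr a ` obj R"
  using assms unfolding homs_to_def by (auto elim!: mor_arrE)

lemma cmp_arr [simp]:
  assumes "a \<in> obj R" "b \<in> obj R" "c \<in> obj R"
  shows "cmp R (arr a b) (arr b c) = arr a c"
  using assms arr_homs arr_eqI cmp_closed by metis

lemma idt_arr:
  assumes "a \<in> obj R"
  shows "idt R a = arr a a"
  using assms idt_closed arr_eqI by blast

lemma ginv_arr [simp]:
  assumes "a \<in> obj R" "b \<in> obj R"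
  shows "ginv R (arr a b) = arr b a"
proof -
  have *: "g = arr b a" if "is_inverse R (arr a b) g" for g
    using that arr_eqI assms unfolding is_inverse_def by simp
  obtain g where g: "is_inverse R (arr a b) g" using inverse_exists[of "arr a b"] assms by auto
  show ?thesis unfolding ginv_def by (rule the_equality) (use g *[OF g] in \<open>simp, intro *\<close>)
qed

lemma act_arr_root [simp]:
  assumes "a \<in> obj R" "b \<in> obj R" "x \<in> roots R b"
  shows "act R (arr a b) x \<in> roots R a"
  using act_closed[OF arr_homs] assms by blast

lemma act_arr_arr [simp]:
  assumes "a \<in> obj R" "b \<in> obj R" "c \<in> obj R" "x \<in> roots R c"
  shows "act R (arr a b) (act R (arr b c) x) = act R (arr a c) x"
  using act_cmp[OF arr_homs arr_homs] assms by simp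

lemma act_arr_self [simp]:
  assumes "a \<in> obj R" "x \<in> roots R a"
  shows "act R (arr a a) x = x"
  using act_idt assms idt_arr by metis

lemma pos_roots:
  assumes "a \<in> obj R" "x \<in> pos R a"
  shows "x \<in> roots R a"
  using definitely_involutedD(1)[OF involuted] assms by blast

lemma rneg_pos_iff:
  assumes "a \<in> obj R" "x \<in> roots R a"
  shows "rneg R a x \<in> pos R a \<longleftrightarrow> x \<notin> pos R a"
  using definitely_involutedD(4)[OF involuted] assms by blast

lemma rneg_root [simp]:
  assumes "a \<in> obj R" "x \<in> roots R a"
  shows "rneg R a x \<in> roots R a" "rneg R a (rneg R a x) = x"
  using definitely_involutedD(2,3)[OF involuted] assms by blast+

lemma negs_iff:
  assumes "a \<in> obj R"
  shows "x \<in> negs R a \<longleftrightarrow> x \<in> roots R a \<and> x \<notin> pos R a"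
  unfolding negs_def using definitely_involutedD(5)[OF involuted] assms by blast

lemma act_arr_neg:
  assumes "a \<in> obj R" "b \<in> obj R" "x \<in> roots R b"
  shows "act R (arr a b) (rneg R b x) = rneg R a (act R (arr a b) x)"
  using act_neg[OF arr_homs] assms by blast

lemma inversions_arr_iff:
  assumes "a \<in> obj R" "b \<in> obj R"
  shows "x \<in> inversions R (arr a b) \<longleftrightarrow> x \<in> pos R a \<and> act R (arr b a) x \<notin> pos R b"
  using assms pos_roots by (auto simp: inversions_def negs_iff)

section \<open>Inversion sets as differences of chambers\<close>

definition chamber :: "'o \<Rightarrow> 'r set" where
  "chamber a = {e \<in> roots R base. act R (arr a base) e \<in> pos R a}"

lemma chamber_roots: "chamber a \<subseteq> roots R base"
  unfolding chamber_def by blast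

lemma inj_act:
  assumes "a \<in> obj R"
  shows "inj_on (act R (arr a base)) (roots R base)"
  by (rule inj_on_inverseI[of _ "act R (arr base a)"]) (use assms base in simp)

lemma inversions_arr:
  assumes a: "a \<in> obj R" and b: "b \<in> obj R"
  shows "inversions R (arr a b) = act R (arr a base) ` (chamber a - chamber b)"
proof (intro Set.set_eqI iffI)
  fix x assume x: "x \<in> inversions R (arr a b)"
  then have xa: "x \<in> roots R a" using pos_roots assms by (simp add: inversions_arr_iff)
  have "act R (arr base a) x \<in> chamber a - chamber b"
    using x xa assms base by (simp add: inversions_arr_iff chamber_def)
  moreover have "x = act R (arr a base) (act R (arr base a) x)" using xa assms base by simp
  ultimately show "x \<in> act R (arr a base) ` (chamber a - chamber b)" by blast
next
  fix x assume "x \<in> act R (arr a base) ` (chamber a - chamber b)"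
  then show "x \<in> inversions R (arr a b)"
    using assms base by (auto simp: inversions_arr_iff chamber_def)
qed

lemma rneg_chamber_iff:
  assumes "a \<in> obj R" "e \<in> roots R base"
  shows "rneg R base e \<in> chamber a \<longleftrightarrow> e \<notin> chamber a"
  using assms base by (simp add: chamber_def act_arr_neg rneg_pos_iff)

text \<open>Negation exchanges a chamber with its complement. Hence either half of a symmetric
  difference determines the other, and one-sided inversion sets can be compared through
  \<open>sep\<close>.\<close>

lemma chamber_diff_opposite:
  assumes "a \<in> obj R" "b \<in> obj R"
  shows "chamber b - chamber a = rneg R base ` (chamber a - chamber b)"
proof (intro Set.set_eqI iffI)
  fix e assume e: "e \<in> chamber b - chamber a"
  then have "e \<in> roots R base" using chamber_roots by blast
  then have "rneg R base e \<in> chamber a - chamber b" "e = rneg R base (rneg R base e)"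
    using e assms base by (auto simp: rneg_chamber_iff)
  then show "e \<in> rneg R base ` (chamber a - chamber b)" by blast
next
  fix e assume "e \<in> rneg R base ` (chamber a - chamber b)"
  then obtain d where "d \<in> chamber a - chamber b" "e = rneg R base d" by blast
  moreover then have "d \<in> roots R base" using chamber_roots by blast
  ultimately show "e \<in> chamber b - chamber a"
    using assms by (auto simp: rneg_chamber_iff)
qed

lemma chamber_diff_subset_iff:
  assumes "a \<in> obj R" "b \<in> obj R" "c \<in> obj R"
  shows "chamber a - chamber b \<subseteq> chamber a - chamber c \<longleftrightarrow>
    sep (chamber a) (chamber b) \<subseteq> sep (chamber a) (chamber c)" (is "?l \<longleftrightarrow> ?r")
proof
  assume l: ?l
  then have "chamber b - chamber a \<subseteq> chamber c - chamber a"
    unfolding chamber_diff_opposite[OF assms(1,2)] chamber_diff_opposite[OF assms(1,3)]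
    by (rule image_mono)
  with l show ?r unfolding sep_def by blast
qed (auto simp: sep_def)

lemma inversions_subset_iff:
  assumes "a \<in> obj R" "b \<in> obj R" "c \<in> obj R"
  shows "inversions R (arr a b) \<subseteq> inversions R (arr a c) \<longleftrightarrow>
    sep (chamber a) (chamber b) \<subseteq> sep (chamber a) (chamber c)"
proof -
  have "chamber a - chamber b \<subseteq> roots R base" "chamber a - chamber c \<subseteq> roots R base"
    using chamber_roots by blast+
  then show ?thesis
    unfolding inversions_arr[OF assms(1,2)] inversions_arr[OF assms(1,3)]
      chamber_diff_subset_iff[OF assms, symmetric]
    by (rule inj_on_image_subset_iff[OF inj_act[OF assms(1)]])
qed

lemma inversions_disjoint_iff:
  assumes "a \<in> obj R" "b \<in> obj R" "c \<in> obj R"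
  shows "inversions R (arr a b) \<inter> inversions R (arr a c) = {} \<longleftrightarrow>
    sep (chamber a) (chamber b) \<inter> sep (chamber a) (chamber c) = {}"
proof -
  have sub: "chamber a - chamber b \<subseteq> roots R base" "chamber a - chamber c \<subseteq> roots R base"
    using chamber_roots by blast+
  have injn: "inj_on (rneg R base) (roots R base)"
    by (rule inj_on_inverseI[of _ "rneg R base"]) (use base in simp)
  have 1: "inversions R (arr a b) \<inter> inversions R (arr a c) =
    act R (arr a base) ` ((chamber a - chamber b) \<inter> (chamber a - chamber c))"
    using inj_on_image_Int[OF inj_act[OF assms(1)] sub] inversions_arr assms by simp
  \<comment> \<open>The opposite halves meet in the negatives of the original intersection, so one
    intersection is empty exactly when the other is.\<close>
  have 2: "(chamber b - chamber a) \<inter> (chamber c - chamber a) =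
    rneg R base ` ((chamber a - chamber b) \<inter> (chamber a - chamber c))"
    using inj_on_image_Int[OF injn sub]
    by (simp only: chamber_diff_opposite[OF assms(1,2)] chamber_diff_opposite[OF assms(1,3)])
  have "(chamber a - chamber b) \<inter> (chamber a - chamber c) = {} \<longleftrightarrow>
    sep (chamber a) (chamber b) \<inter> sep (chamber a) (chamber c) = {}" (is "?l \<longleftrightarrow> ?r")
  proof
    assume ?l
    then have "(chamber b - chamber a) \<inter> (chamber c - chamber a) = {}" using 2 by simp
    then show ?r using \<open>?l\<close> unfolding sep_def by blast
  qed (auto simp: sep_def)
  then show ?thesis using 1 by simp
qed

lemma inversions_empty_iff:
  assumes "a \<in> obj R" "b \<in> obj R"
  shows "inversions R (arr a b) = {} \<longleftrightarrow> chamber a = chamber b"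
  using inversions_disjoint_iff[OF assms(1,2,2)] by (simp add: sep_empty_iff)

text \<open>The inversion set of an arrow vanishes exactly when its endpoints have equal chambers,
  while the identities are the arrows with equal endpoints.\<close>

lemma faithful_iff: "faithful R \<longleftrightarrow> inj_on chamber (obj R)"
proof
  assume f: "faithful R"
  show "inj_on chamber (obj R)"
  proof (rule inj_onI)
    fix a b assume ab: "a \<in> obj R" "b \<in> obj R" "chamber a = chamber b"
    then have "inversions R (arr a b) = {}" by (simp add: inversions_empty_iff)
    then obtain c where "c \<in> obj R" "arr a b = idt R c"
      using f ab arr_simps(1) unfolding faithful_def by blast
    then have "arr a b = arr c c" by (simp add: idt_arr)
    then show "a = b" using ab \<open>c \<in> obj R\<close> arr_simps(2,3) by metis
  qed
next
  assume i: "inj_on chamber (obj R)"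
  show "faithful R" unfolding faithful_def
  proof (intro ballI impI)
    fix g assume "g \<in> mor R" and e: "inversions R g = {}"
    then obtain a b where ab: "a \<in> obj R" "b \<in> obj R" "g = arr a b" by (blast elim: mor_arrE)
    then have "a = b" using e i inversions_empty_iff by (metis inj_onD)
    then show "\<exists>a\<in>obj R. g = idt R a" using ab idt_arr by metis
  qed
qed

section \<open>Weak orders, completeness and preprincipality read off from chambers\<close>

lemma weak_order_simps:
  "carrier (weak_order R a) = homs_to R a" "eq (weak_order R a) = (=)"
  "g \<sqsubseteq>\<^bsub>weak_order R a\<^esub> h \<longleftrightarrow> inversions R g \<subseteq> inversions R h"
  unfolding weak_order_def by simp_all

lemma weak_order_arr_iff:
  assumes "a \<in> obj R" "b \<in> obj R" "c \<in> obj R"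
  shows "arr a b \<sqsubseteq>\<^bsub>weak_order R a\<^esub> arr a c \<longleftrightarrow>
    sep (chamber a) (chamber b) \<subseteq> sep (chamber a) (chamber c)"
  using inversions_subset_iff[OF assms] by (simp add: weak_order_simps)

text \<open>Only antisymmetry needs faithfulness: equal separating sets give equal chambers, hence
  equal objects.\<close>

lemma weak_order_partial_order:
  assumes f: "faithful R" and a: "a \<in> obj R"
  shows "partial_order (weak_order R a)"
proof (unfold_locales; (unfold weak_order_simps)?)
  fix x y assume le: "inversions R x \<subseteq> inversions R y" "inversions R y \<subseteq> inversions R x"
    and xy: "x \<in> homs_to R a" "y \<in> homs_to R a"
  then obtain b c where bc: "b \<in> obj R" "x = arr a b" "c \<in> obj R" "y = arr a c"
    using a by (auto simp: homs_to_eq)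
  have "sep (chamber a) (chamber b) = sep (chamber a) (chamber c)"
    using le bc a inversions_subset_iff by (intro equalityI) auto
  then have "b = c" using bc f unfolding sep_left_cancel faithful_iff by (auto dest: inj_onD)
  then show "x = y" using bc by simp
qed auto

lemma is_lub_arr_iff:
  assumes a: "a \<in> obj R" and j: "j \<in> obj R" and B: "B \<subseteq> obj R"
  shows "is_lub (weak_order R a) (arr a j) (arr a ` B) \<longleftrightarrow>
    is_join (chamber ` obj R) (chamber a) (chamber ` B) (chamber j)"
proof -
  have up: "Upper (weak_order R a) (arr a ` B) =
      arr a ` {u \<in> obj R. \<forall>b\<in>B. sep (chamber a) (chamber b) \<subseteq> sep (chamber a) (chamber u)}"
    (is "_ = arr a ` ?U")
  proof -
    have "Upper (weak_order R a) (arr a ` B) =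
        {u \<in> arr a ` obj R. \<forall>b\<in>B. arr a b \<sqsubseteq>\<^bsub>weak_order R a\<^esub> u}"
      unfolding Upper_def weak_order_simps(1) homs_to_eq[OF a] using B by blast
    also have "\<dots> = arr a ` {u \<in> obj R. \<forall>b\<in>B. arr a b \<sqsubseteq>\<^bsub>weak_order R a\<^esub> arr a u}" by blast
    also have "{u \<in> obj R. \<forall>b\<in>B. arr a b \<sqsubseteq>\<^bsub>weak_order R a\<^esub> arr a u} = ?U"
      using B weak_order_arr_iff[OF a] by blast
    finally show ?thesis .
  qed
  have sub: "arr a ` ?U \<subseteq> homs_to R a" using a by (auto simp: homs_to_eq)
  have inj: "inj_on (arr a) (obj R)" using a by (auto simp: inj_on_def arr_eq_iff)
  have mem: "arr a j \<in> arr a ` ?U \<longleftrightarrow> j \<in> ?U"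
    by (rule inj_on_image_mem_iff[OF inj j]) blast
  have low: "(\<forall>x\<in>arr a ` ?U. arr a j \<sqsubseteq>\<^bsub>weak_order R a\<^esub> x) \<longleftrightarrow>
      (\<forall>u\<in>?U. sep (chamber a) (chamber j) \<subseteq> sep (chamber a) (chamber u))"
    using weak_order_arr_iff a j by auto
  show ?thesis unfolding least_def up low mem unfolding weak_order_simps is_join_def
    using sub j by auto
qed

lemma complete_sgset_iff:
  assumes f: "faithful R"
  shows "complete_sgset R \<longleftrightarrow> complete_family (chamber ` obj R)"
proof
  assume c: "complete_sgset R"
  show "complete_family (chamber ` obj R)" unfolding complete_family_def
  proof (intro ballI allI impI)
    fix A \<A> assume "A \<in> chamber ` obj R" "\<A> \<subseteq> chamber ` obj R"
    then obtain a B where aB: "a \<in> obj R" "A = chamber a" "B \<subseteq> obj R" "\<A> = chamber ` B"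
      by (auto simp: subset_image_iff)
    interpret L: complete_lattice "weak_order R a" using c aB unfolding complete_sgset_def by blast
    have "arr a ` B \<subseteq> carrier (weak_order R a)" using aB by (auto simp: weak_order_simps homs_to_eq)
    from L.sup_exists[OF this] obtain s where s: "is_lub (weak_order R a) s (arr a ` B)" by blast
    then have "s \<in> homs_to R a" using least_closed weak_order_simps(1) by metis
    then obtain j where "j \<in> obj R" "s = arr a j" using aB by (auto simp: homs_to_eq)
    then show "\<exists>J. is_join (chamber ` obj R) A \<A> J" using s is_lub_arr_iff aB by metis
  qed
next
  assume c: "complete_family (chamber ` obj R)"
  have "complete_lattice (weak_order R a)" if a: "a \<in> obj R" for a
  proof -
    interpret L: partial_order "weak_order R a" by (rule weak_order_partial_order[OF f a])
    have sup: "\<exists>s. is_lub (weak_order R a) s H" if "H \<subseteq> carrier (weak_order R a)" for H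
    proof -
      have "H \<subseteq> arr a ` obj R" using that weak_order_simps(1) homs_to_eq[OF a] by simp
      then obtain B where B: "B \<subseteq> obj R" "H = arr a ` B" by (auto simp: subset_image_iff)
      have "chamber a \<in> chamber ` obj R" "chamber ` B \<subseteq> chamber ` obj R" using a B by auto
      with c obtain J where J: "is_join (chamber ` obj R) (chamber a) (chamber ` B) J"
        unfolding complete_family_def by blast
      then obtain j where "j \<in> obj R" "J = chamber j" using is_joinD(1) by blast
      then show ?thesis using J is_lub_arr_iff a B by metis
    qed
    show ?thesis
    proof (rule L.complete_latticeI)
      fix H assume H: "H \<subseteq> carrier (weak_order R a)"
      show "\<exists>s. is_lub (weak_order R a) s H" by (rule sup[OF H])
      \<comment> \<open>The meet of H is built as the join of its lower bounds.\<close>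
      obtain s where s: "is_lub (weak_order R a) s (Lower (weak_order R a) H)"
        using sup[of "Lower (weak_order R a) H"] by auto
      have "is_glb (weak_order R a) s H"
      proof (rule greatest_LowerI)
        show "H \<subseteq> carrier (weak_order R a)" by (rule H)
        show "s \<in> carrier (weak_order R a)" using least_closed[OF s] by simp
        show "s \<sqsubseteq>\<^bsub>weak_order R a\<^esub> x" if x: "x \<in> H" for x
        proof (rule least_le[OF s], rule Upper_memI)
          show "x \<in> carrier (weak_order R a)" using x H by blast
          show "y \<sqsubseteq>\<^bsub>weak_order R a\<^esub> x" if "y \<in> Lower (weak_order R a) H" for y
            using Lower_memD[OF that x H] by blast
        qed
        show "y \<sqsubseteq>\<^bsub>weak_order R a\<^esub> s" if "y \<in> Lower (weak_order R a) H" for y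
          using least_Upper_above[OF s that] by simp
      qed
      then show "\<exists>i. is_glb (weak_order R a) i H" by blast
    qed
  qed
  then show "complete_sgset R" using f unfolding complete_sgset_def by blast
qed

lemma least_weak_order_arr_iff:
  assumes a: "a \<in> obj R" and b: "b \<in> obj R"
  shows "least (weak_order R a) (arr a b) (homs_to R a) \<longleftrightarrow> chamber b = chamber a"
proof -
  have "least (weak_order R a) (arr a b) (homs_to R a) \<longleftrightarrow>
      (\<forall>c\<in>obj R. sep (chamber a) (chamber b) \<subseteq> sep (chamber a) (chamber c))"
    unfolding least_def weak_order_simps(1) using a b weak_order_arr_iff homs_to_eq[OF a] by auto
  \<comment> \<open>Comparing with c = a, where the separating set is empty, forces the least
    element to have the chamber of a.\<close>
  also have "\<dots> \<longleftrightarrow> sep (chamber a) (chamber b) = {}"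
    using a sep_empty_iff[of "chamber a" "chamber a"] by blast
  finally show ?thesis by (auto simp: sep_empty_iff)
qed

lemma atomic_arr_iff:
  assumes f: "faithful R" and a: "a \<in> obj R" and s: "s \<in> obj R"
  shows "atomic R (arr a s) \<longleftrightarrow> adjacent (chamber ` obj R) (chamber a) (chamber s)"
proof -
  have eq: "arr a y = arr a s \<longleftrightarrow> chamber y = chamber s" if "y \<in> obj R" for y
    using f a s that arr_eq_iff unfolding faithful_iff by (metis inj_onD)
  have "atomic R (arr a s) \<longleftrightarrow> chamber s \<noteq> chamber a \<and>
    (\<forall>y\<in>obj R. sep (chamber a) (chamber y) \<subseteq> sep (chamber a) (chamber s) \<longrightarrow>
       chamber y = chamber a \<or> chamber y = chamber s)"
    unfolding atomic_def is_atom_def arr_simps(2)[OF a s] weak_order_simps(1) homs_to_eq[OF a]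
    using a s least_weak_order_arr_iff[OF a] eq weak_order_arr_iff[OF a] homs_to_eq[OF a] by auto
  then show ?thesis using s unfolding adjacent_def by auto
qed

lemma finite_homs_to:
  assumes "finite_sgset R"
  shows "finite (homs_to R a)"
  using assms unfolding finite_sgset_def homs_to_def by auto

text \<open>Finiteness of the groupoid makes interval finiteness automatic, so only the dichotomy
  for atoms has to be translated.\<close>

lemma preprincipal_iff:
  assumes f: "faithful R" and fin: "finite_sgset R"
  shows "preprincipal R \<longleftrightarrow> preprincipal_family (chamber ` obj R)"
proof -
  have "interval_finite R" unfolding interval_finite_def using finite_homs_to[OF fin] by auto
  then have "preprincipal R \<longleftrightarrow>
     (\<forall>a\<in>obj R. \<forall>s\<in>obj R. \<forall>b\<in>obj R. atomic R (arr a s) \<longrightarrow>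
        inversions R (arr a s) \<subseteq> inversions R (arr a b) \<or>
        inversions R (arr a s) \<inter> inversions R (arr a b) = {})"
    unfolding preprincipal_def using f by (simp add: homs_to_eq) blast
  also have "\<dots> \<longleftrightarrow> (\<forall>a\<in>obj R. \<forall>s\<in>obj R. \<forall>b\<in>obj R.
      adjacent (chamber ` obj R) (chamber a) (chamber s) \<longrightarrow>
        sep (chamber a) (chamber s) \<subseteq> sep (chamber a) (chamber b) \<or>
        sep (chamber a) (chamber s) \<inter> sep (chamber a) (chamber b) = {})"
    by (simp add: inversions_subset_iff inversions_disjoint_iff atomic_arr_iff[OF f] cong: ball_cong)
  finally show ?thesis unfolding preprincipal_family_def by simp
qed

lemma finite_obj:
  assumes "finite_sgset R"
  shows "finite (obj R)"
proof (rule finite_surj)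
  show "finite (mor R)" using assms unfolding finite_sgset_def by blast
  show "obj R \<subseteq> tgt R ` mor R" using arr_simps(1,2) by (metis image_eqI subsetI)
qed

end

section \<open>Components of the box construction\<close>

context indiscrete_sgset
begin

text \<open>For (a, X) these are the inversion sets of the morphisms in X, transported to the base
  object. This is the complete invariant of a component when R is faithful.\<close>

definition trace :: "'o \<times> 'm set \<Rightarrow> 'r set set" where
  "trace p = (\<lambda>g. chamber (fst p) - chamber (src R g)) ` snd p"

definition box_part :: "'r set set \<Rightarrow>
    ('o \<times> 'm set, ('o \<times> 'm set) \<times> 'm \<times> ('o \<times> 'm set), 'r) sgset" where
  "box_part T = restrict_sgset (box_sgset R) {p \<in> obj (box_sgset R). trace p = T}"

lemma box_obj: "obj (box_sgset R) = {(a, X). a \<in> obj R \<and> X \<subseteq> homs_to R a}"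
  by (simp add: box_sgset_def)

text \<open>Commutativity is automatic because the fourth side is the unique arrow. The remaining
  condition compares two inversion sets, and transport to the base cancels the action of the top
  arrow.\<close>

lemma is_square_arr_iff:
  assumes a: "a \<in> obj R" and b: "b \<in> obj R" and x: "x \<in> obj R" and y: "y \<in> obj R"
  shows "is_square R (arr b a) (arr a x) (arr b y) (cmp R (ginv R (arr b y)) (cmp R (arr b a) (arr a x)))
    \<longleftrightarrow> chamber a - chamber x = chamber b - chamber y"
proof -
  have z: "cmp R (ginv R (arr b y)) (cmp R (arr b a) (arr a x)) = arr y x" using assms by simp
  have "(\<exists>a'\<in>obj R. \<exists>b'\<in>obj R. \<exists>c\<in>obj R. \<exists>d\<in>obj R. arr a x \<in> homs R b' a' \<and>
      arr b a \<in> homs R d b' \<and> arr y x \<in> homs R c a' \<and> arr b y \<in> homs R d c)"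
    using arr_homs assms by blast
  moreover have "cmp R (arr b a) (arr a x) = cmp R (arr b y) (arr y x)" using assms by simp
  moreover have "act R (arr b a) ` inversions R (arr a x) =
      act R (arr b base) ` (chamber a - chamber x)"
    unfolding inversions_arr[OF a x] image_image
    by (rule image_cong) (use a b base chamber_roots in \<open>auto intro: act_arr_arr\<close>)
  moreover have "act R (arr b base) ` (chamber a - chamber x) = act R (arr b base) ` (chamber b - chamber y)
      \<longleftrightarrow> chamber a - chamber x = chamber b - chamber y"
    by (rule inj_on_image_eq_iff[OF inj_act[OF b]]) (use chamber_roots in blast)+
  ultimately show ?thesis unfolding z is_square_def inversions_arr[OF b y] by simp
qed

text \<open>The difference on one side fixes its opposite, hence the chamber of the source, hence
  the source by faithfulness. So X can be recovered from a and the trace of (a, X).\<close>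

lemma chamber_diff_inj:
  assumes f: "faithful R" and a: "a \<in> obj R"
  shows "inj_on (\<lambda>g. chamber a - chamber (src R g)) (homs_to R a)"
proof (rule inj_onI)
  fix g h assume "g \<in> homs_to R a" "h \<in> homs_to R a"
    and e: "chamber a - chamber (src R g) = chamber a - chamber (src R h)"
  then obtain x y where xy: "x \<in> obj R" "y \<in> obj R" "g = arr a x" "h = arr a y"
    using homs_to_eq[OF a] by blast
  then have e: "chamber a - chamber x = chamber a - chamber y" using e a by simp
  then have "chamber x - chamber a = chamber y - chamber a"
    unfolding chamber_diff_opposite[OF a xy(1)] chamber_diff_opposite[OF a xy(2)] by simp
  with e have "chamber x = chamber y" by blast
  then show "g = h" using xy f unfolding faithful_iff by (auto dest: inj_onD)
qed

lemma box_mor_iff: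
  assumes f: "faithful R" and p: "(a, X) \<in> obj (box_sgset R)" and q: "(b, Y) \<in> obj (box_sgset R)"
  shows "box_mor R f a X b Y \<longleftrightarrow> f = arr b a \<and> trace (a, X) = trace (b, Y)"
proof -
  have a: "a \<in> obj R" "X \<subseteq> homs_to R a" and b: "b \<in> obj R" "Y \<subseteq> homs_to R b"
    using p q unfolding box_obj by auto
  define \<phi> \<psi> where "\<phi> g = chamber a - chamber (src R g)" and "\<psi> g = chamber b - chamber (src R g)" for g
  have sq: "is_square R (arr b a) g h (cmp R (ginv R h) (cmp R (arr b a) g)) \<longleftrightarrow> \<phi> g = \<psi> h"
    if "g \<in> X" "h \<in> Y" for g h
  proof -
    have "g \<in> arr a ` obj R" "h \<in> arr b ` obj R"
      using that a(2) b(2) unfolding homs_to_eq[OF a(1)] homs_to_eq[OF b(1)] by auto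
    then obtain x y where xy: "x \<in> obj R" "g = arr a x" "y \<in> obj R" "h = arr b y" by blast
    then show ?thesis using is_square_arr_iff a b by (simp add: \<phi>_def \<psi>_def)
  qed
  have tr: "trace (a, X) = \<phi> ` X" "trace (b, Y) = \<psi> ` Y"
    unfolding trace_def \<phi>_def \<psi>_def by auto
  show ?thesis
  proof
    assume "box_mor R f a X b Y"
    then obtain \<sigma> where f': "f \<in> homs R b a" and bij: "bij_betw \<sigma> X Y"
      and sqs: "\<forall>g\<in>X. is_square R f g (\<sigma> g) (cmp R (ginv R (\<sigma> g)) (cmp R f g))"
      unfolding box_mor_def by blast
    have fa: "f = arr b a" using f' by (rule arr_eqI)
    have Y: "\<sigma> ` X = Y" using bij by (rule bij_betw_imp_surj_on)
    then have "\<phi> g = \<psi> (\<sigma> g)" if "g \<in> X" for g using sqs sq[of g "\<sigma> g"] that fa by blast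
    then have "\<phi> ` X = \<psi> ` \<sigma> ` X" unfolding image_image by (rule image_cong[OF refl])
    then show "f = arr b a \<and> trace (a, X) = trace (b, Y)" using fa Y tr by simp
  next
    assume fT: "f = arr b a \<and> trace (a, X) = trace (b, Y)"
    have \<phi>: "bij_betw \<phi> X (\<phi> ` X)"
      using chamber_diff_inj[OF f a(1)] a(2) inj_on_subset
      unfolding \<phi>_def by (intro inj_on_imp_bij_betw) blast
    have \<psi>: "bij_betw \<psi> Y (\<phi> ` X)"
      using chamber_diff_inj[OF f b(1)] b(2) inj_on_subset fT tr
      unfolding \<psi>_def by (intro bij_betw_imageI) (blast, simp)
    \<comment> \<open>The square condition dictates the bijection: g must go to the unique member of
      Y with the same transported inversion set.\<close>
    define \<sigma> where "\<sigma> = inv_into Y \<psi> \<circ> \<phi>"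
    have bij: "bij_betw \<sigma> X Y"
      unfolding \<sigma>_def by (rule bij_betw_trans[OF \<phi> bij_betw_inv_into[OF \<psi>]])
    have "\<psi> (\<sigma> g) = \<phi> g" "\<sigma> g \<in> Y" if "g \<in> X" for g
      using that bij_betw_inv_into_right[OF \<psi>] bij_betw_apply[OF bij] by (auto simp: \<sigma>_def)
    then show "box_mor R f a X b Y"
      using fT arr_homs a b bij sq unfolding box_mor_def by (metis (no_types, lifting))
  qed
qed

lemma box_mor_set:
  assumes "faithful R"
  shows "mor (box_sgset R) = {(q, arr (fst q) (fst p), p) | p q.
    p \<in> obj (box_sgset R) \<and> q \<in> obj (box_sgset R) \<and> trace p = trace q}"
proof -
  have "mor (box_sgset R) = {((b, Y), f, (a, X)) | a X b Y f. (a, X) \<in> obj (box_sgset R) \<and>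
      (b, Y) \<in> obj (box_sgset R) \<and> box_mor R f a X b Y}"
    by (simp add: box_sgset_def)
  also have "\<dots> = {(q, f, p) | p q f. p \<in> obj (box_sgset R) \<and> q \<in> obj (box_sgset R) \<and>
      box_mor R f (fst p) (snd p) (fst q) (snd q)}" by force
  also have "\<dots> = {(q, f, p) | p q f. p \<in> obj (box_sgset R) \<and> q \<in> obj (box_sgset R) \<and>
      f = arr (fst q) (fst p) \<and> trace p = trace q}"
    using box_mor_iff[OF assms, of "fst _" "snd _" "fst _" "snd _"] by (metis (lifting) prod.collapse)
  finally show ?thesis by blast
qed

lemma box_part_simps:
  "src (box_part T) (q, f, p) = p" "tgt (box_part T) (q, f, p) = q"
  "idt (box_part T) p = (p, idt R (fst p), p)"
  "cmp (box_part T) (r, f, q) (q', g, p) = (r, cmp R f g, p)"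
  "roots (box_part T) p = roots R (fst p)" "pos (box_part T) p = pos R (fst p)"
  "rneg (box_part T) p = rneg R (fst p)" "act (box_part T) (q, f, p) = act R f"
  unfolding box_part_def restrict_sgset_def box_sgset_def by simp_all

lemma box_part_obj:
  "obj (box_part T) = {p. fst p \<in> obj R \<and> snd p \<subseteq> homs_to R (fst p) \<and> trace p = T}"
  unfolding box_part_def restrict_sgset_def by (auto simp: box_obj)

lemma box_part_mor:
  assumes "faithful R"
  shows "mor (box_part T) =
    {(q, arr (fst q) (fst p), p) | p q. p \<in> obj (box_part T) \<and> q \<in> obj (box_part T)}"
proof -
  have "src (box_sgset R) (q, f, p) = p" "tgt (box_sgset R) (q, f, p) = q" for q p f
    unfolding box_sgset_def by simp_all
  then show ?thesis unfolding box_part_def restrict_sgset_def by (auto simp: box_mor_set[OF assms])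
qed

lemma box_part_homs:
  assumes "faithful R"
  shows "homs (box_part T) q p =
    (if p \<in> obj (box_part T) \<and> q \<in> obj (box_part T) then {(q, arr (fst q) (fst p), p)} else {})"
  unfolding homs_def box_part_mor[OF assms] by (auto simp: box_part_simps)

lemma box_homs_nonempty_iff:
  assumes "faithful R" "p \<in> obj (box_sgset R)" "q \<in> obj (box_sgset R)"
  shows "homs (box_sgset R) q p \<noteq> {} \<longleftrightarrow> trace q = trace p"
proof -
  have st: "src (box_sgset R) (q, f, p) = p" "tgt (box_sgset R) (q, f, p) = q" for q p f
    unfolding box_sgset_def by simp_all
  have "f \<in> homs (box_sgset R) q p \<longleftrightarrow> f = (q, arr (fst q) (fst p), p) \<and> trace q = trace p" for f
    unfolding homs_def box_mor_set[OF assms(1)] using assms(2,3) st by (cases f) fastforce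
  then show ?thesis by blast
qed

text \<open>Two objects of the box groupoid are joined by a morphism exactly when their traces
  agree.\<close>

lemma component_box_part:
  assumes "faithful R" "p \<in> obj (box_sgset R)"
  shows "restrict_sgset (box_sgset R) {q \<in> obj (box_sgset R). homs (box_sgset R) q p \<noteq> {}} =
    box_part (trace p)"
  unfolding box_part_def using box_homs_nonempty_iff[OF assms] by (metis (lifting))

text \<open>With the trace fixed, the endpoints leave one choice for the underlying arrow, so all
  the laws reduce to those for arrows of R.\<close>

lemma box_part_indiscrete:
  assumes f: "faithful R" and p: "p \<in> obj (box_part T)"
  shows "indiscrete_sgset (box_part T) p"
proof
  let ?S = "box_part T"
  note homs = box_part_homs[OF f]
  have ob: "fst q \<in> obj R" if "q \<in> obj ?S" for q using that by (simp add: box_part_obj)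
  show "groupoid_connected ?S" "groupoid_simply_connected ?S"
    unfolding groupoid_connected_def groupoid_simply_connected_def using p by (auto simp: homs)
  show "p \<in> obj ?S" by (rule p)
  show "src ?S g \<in> obj ?S" "tgt ?S g \<in> obj ?S" if "g \<in> mor ?S" for g
    using that by (auto simp: box_part_mor[OF f] box_part_simps)
  show "idt ?S a \<in> homs ?S a a" if "a \<in> obj ?S" for a
    using that ob by (simp add: homs box_part_simps idt_arr)
  show "cmp ?S g h \<in> homs ?S a c" if "g \<in> homs ?S a b" "h \<in> homs ?S b c" for g h a b c
    using that ob by (simp add: homs box_part_simps split: if_splits)
  show "cmp ?S (cmp ?S g h) k = cmp ?S g (cmp ?S h k)"
    if "g \<in> homs ?S a b" "h \<in> homs ?S b c" "k \<in> homs ?S c d" for g h k a b c d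
    using that ob by (simp add: homs box_part_simps split: if_splits)
  show "cmp ?S (idt ?S a) g = g" "cmp ?S g (idt ?S b) = g" if "g \<in> homs ?S a b" for g a b
    using that ob by (simp_all add: homs box_part_simps idt_arr split: if_splits)
  show "\<exists>h. is_inverse ?S g h" if g: "g \<in> mor ?S" for g
  proof -
    obtain a b where ab: "a \<in> obj ?S" "b \<in> obj ?S" "g = (b, arr (fst b) (fst a), a)"
      using g by (auto simp: box_part_mor[OF f])
    then have "is_inverse ?S g (a, arr (fst a) (fst b), b)"
      using ob unfolding is_inverse_def by (simp add: homs box_part_simps idt_arr)
    then show ?thesis by blast
  qed
  show "definitely_involuted_set (roots ?S a) (pos ?S a) (rneg ?S a)" if "a \<in> obj ?S" for a
    using involuted[OF ob[OF that]] by (simp add: box_part_simps)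
  show "act ?S g x \<in> roots ?S a" if "g \<in> homs ?S a b" "x \<in> roots ?S b" for g a b x
    using that ob by (simp add: homs box_part_simps split: if_splits)
  show "act ?S (idt ?S a) x = x" if "a \<in> obj ?S" "x \<in> roots ?S a" for a x
    using that act_idt[OF ob] by (simp add: box_part_simps)
  show "act ?S g (act ?S h x) = act ?S (cmp ?S g h) x"
    if "g \<in> homs ?S a b" "h \<in> homs ?S b c" "x \<in> roots ?S c" for g h a b c x
    using that ob by (simp add: homs box_part_simps split: if_splits)
  show "act ?S g (rneg ?S b x) = rneg ?S a (act ?S g x)"
    if "g \<in> homs ?S a b" "x \<in> roots ?S b" for g a b x
    using that ob act_arr_neg by (simp add: homs box_part_simps split: if_splits)
qed

section \<open>Chambers of a component\<close>

lemma box_part_arr: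
  assumes f: "faithful R" and p: "p \<in> obj (box_part T)" "q \<in> obj (box_part T)"
  shows "indiscrete_sgset.arr (box_part T) q p = (q, arr (fst q) (fst p), p)"
  using indiscrete_sgset.arr_homs[OF box_part_indiscrete[OF f p(1)] p(2,1)]
  by (simp add: box_part_homs[OF f] p)

text \<open>When p lies over \<open>base\<close>, the component at p and R at \<open>base\<close>
  have the same roots, and transport uses the same arrows; the chambers are therefore literally the
  same sets.\<close>

lemma box_part_chamber:
  assumes f: "faithful R" and p: "p \<in> obj (box_part T)" "fst p = base" and q: "q \<in> obj (box_part T)"
  shows "indiscrete_sgset.chamber (box_part T) p q = chamber (fst q)"
  unfolding indiscrete_sgset.chamber_def[OF box_part_indiscrete[OF f p(1)]] chamber_def
  by (simp add: box_part_arr[OF f p(1) q] box_part_simps p(2))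

text \<open>This identifies a component with an abstract shiftable subfamily, so that the closure
  results for such subfamilies apply.\<close>

lemma chamber_box_part:
  "(\<lambda>q. chamber (fst q)) ` obj (box_part T) =
    shiftable (chamber ` obj R) ((\<lambda>D. (D, rneg R base ` D)) ` T)"
proof (intro Set.set_eqI iffI)
  fix B assume "B \<in> (\<lambda>q. chamber (fst q)) ` obj (box_part T)"
  then obtain b Y where b: "b \<in> obj R" "Y \<subseteq> homs_to R b" "trace (b, Y) = T" "B = chamber b"
    by (auto simp: box_part_obj)
  show "B \<in> shiftable (chamber ` obj R) ((\<lambda>D. (D, rneg R base ` D)) ` T)"
  proof (rule shiftableI)
    fix D D' assume "(D, D') \<in> (\<lambda>D. (D, rneg R base ` D)) ` T"
    then have D: "D \<in> trace (b, Y)" "D' = rneg R base ` D" using b by auto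
    then obtain g where g: "g \<in> Y" "D = chamber b - chamber (src R g)" unfolding trace_def by auto
    then obtain y where "y \<in> obj R" "g = arr b y" using b homs_to_eq by blast
    then have y: "y \<in> obj R" "D = chamber b - chamber y" using g b by auto
    then have "D' = chamber y - chamber b" using D chamber_diff_opposite[OF b(1) y(1)] by simp
    then show "\<exists>Y\<in>chamber ` obj R. B - Y = D \<and> Y - B = D'" using y b by blast
  qed (use b in blast)
next
  fix B assume B: "B \<in> shiftable (chamber ` obj R) ((\<lambda>D. (D, rneg R base ` D)) ` T)"
  obtain b where b: "b \<in> obj R" "B = chamber b" using shiftableD(1)[OF B] by blast
  \<comment> \<open>Y collects all arrows into b whose difference lies in T; shiftability guarantees
    that every member of T is attained.\<close>
  define Y where "Y = arr b ` {y \<in> obj R. chamber b - chamber y \<in> T}"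
  have "\<exists>y\<in>obj R. chamber b - chamber y = D" if "D \<in> T" for D
    using shiftableD(2)[OF B, of D "rneg R base ` D"] that b by auto
  then have "trace (b, Y) = T" unfolding trace_def Y_def using b by (auto simp: image_image)
  then have "(b, Y) \<in> obj (box_part T)" unfolding box_part_obj Y_def using b homs_to_eq by auto
  then show "B \<in> (\<lambda>q. chamber (fst q)) ` obj (box_part T)" using b by force
qed

lemma box_part_properties:
  assumes f: "faithful R" and fin: "finite_sgset R" and pre: "preprincipal R"
    and comp: "complete_sgset R" and p: "p \<in> obj (box_part T)" "fst p = base"
  shows "finite_sgset (box_part T)" "preprincipal (box_part T)" "complete_sgset (box_part T)"
proof -
  interpret S: indiscrete_sgset "box_part T" p by (rule box_part_indiscrete[OF f p(1)])
  have "finite (obj R)" "finite (mor R)" using finite_obj fin unfolding finite_sgset_def by auto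
  moreover have "obj (box_part T) \<subseteq> obj R \<times> Pow (mor R)"
    by (auto simp: box_part_obj homs_to_def)
  ultimately have fo: "finite (obj (box_part T))" by (meson finite_SigmaI finite_Pow_iff finite_subset)
  have "mor (box_part T) =
      (\<lambda>(p, q). (q, arr (fst q) (fst p), p)) ` (obj (box_part T) \<times> obj (box_part T))"
    unfolding box_part_mor[OF f] by force
  then have "finite (mor (box_part T))" using fo by simp
  then show finS: "finite_sgset (box_part T)"
    using fin unfolding finite_sgset_def by (simp add: box_part_simps box_part_obj)
  have ch: "S.chamber q = chamber (fst q)" if "q \<in> obj (box_part T)" for q
    by (rule box_part_chamber[OF f p that])
  have "inj_on S.chamber (obj (box_part T))"
  proof (rule inj_onI)
    fix q q' assume q: "q \<in> obj (box_part T)" "q' \<in> obj (box_part T)" "S.chamber q = S.chamber q'"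
    then have qq: "fst q \<in> obj R" "fst q' \<in> obj R" "chamber (fst q) = chamber (fst q')"
      using ch by (auto simp: box_part_obj)
    then have e: "fst q = fst q'" using f unfolding faithful_iff by (auto dest: inj_onD)
    have "trace q = trace q'" "snd q \<subseteq> homs_to R (fst q)" "snd q' \<subseteq> homs_to R (fst q)"
      using q e by (auto simp: box_part_obj)
    \<comment> \<open>Over one object of R, injectivity of the chamber difference recovers X from
      the common trace T.\<close>
    then have "snd q = snd q'"
      using inj_on_image_eq_iff[OF chamber_diff_inj[OF f qq(1)], of "snd q" "snd q'"]
      by (simp add: trace_def e)
    with e show "q = q'" by (rule prod_eqI)
  qed
  then have fS: "faithful (box_part T)" by (simp add: S.faithful_iff)
  have img: "S.chamber ` obj (box_part T) =
      shiftable (chamber ` obj R) ((\<lambda>D. (D, rneg R base ` D)) ` T)"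
    using ch by (simp flip: chamber_box_part)
  have cf: "complete_family (chamber ` obj R)" using comp complete_sgset_iff[OF f] by blast
  show "complete_sgset (box_part T)"
    unfolding S.complete_sgset_iff[OF fS] img by (rule complete_family_shiftable[OF cf])
  have "preprincipal_family (chamber ` obj R)" using pre preprincipal_iff[OF f fin] by blast
  then show "preprincipal (box_part T)"
    unfolding S.preprincipal_iff[OF fS finS] img
    using preprincipal_family_shiftable[OF _ cf] finite_obj[OF fin] by blast
qed

end

section \<open>Principality\<close>

context indiscrete_sgset
begin

lemma card_inversions_arr:
  assumes "a \<in> obj R" "b \<in> obj R"
  shows "card (inversions R (arr a b)) = card (chamber a - chamber b)"
  unfolding inversions_arr[OF assms]
  by (rule card_image) (use inj_on_subset[OF inj_act[OF assms(1)]] chamber_roots in blast)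

lemma finite_chamber:
  assumes "finite_sgset R"
  shows "finite (chamber a)"
  using assms base finite_subset[OF chamber_roots] unfolding finite_sgset_def by blast

text \<open>An atom below the given arrow is split off on the left. It is simple by hypothesis, so
  the number of inversions drops by exactly one.\<close>

lemma product_of_simple_exists:
  assumes fin: "finite_sgset R" and f: "faithful R"
    and atoms: "\<And>s. atomic R s \<Longrightarrow> card (inversions R s) = 1"
    and a: "a \<in> obj R" and b: "b \<in> obj R"
  shows "\<exists>fs. product_of R (Collect (simple_mor R)) fs (arr a b) \<and> length fs = card (chamber a - chamber b)"
  using a
proof (induction "card (chamber a - chamber b)" arbitrary: a)
  case 0
  then have "chamber a - chamber b = {}" using finite_chamber[OF fin] by simp
  then have "inversions R (arr a b) = {}" using inversions_arr[OF 0(2) b] by simp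
  then have "chamber a = chamber b" using inversions_empty_iff[OF 0(2) b] by simp
  then have "a = b" using f 0(2) b unfolding faithful_iff by (auto dest: inj_onD)
  then have "product_of R (Collect (simple_mor R)) [] (arr a b)"
    using product_Nil[OF b, of "Collect (simple_mor R)"] idt_arr[OF b] by simp
  with 0(1) show ?case by (metis list.size(3))
next
  case (Suc n)
  then have "chamber b \<noteq> chamber a" by auto
  then obtain C where C: "adjacent (chamber ` obj R) (chamber a) C"
      "sep (chamber a) C \<subseteq> sep (chamber a) (chamber b)"
    using adjacent_below[of "chamber ` obj R" "chamber b" "chamber a"] finite_obj[OF fin] b by blast
  then obtain s where s: "s \<in> obj R" "C = chamber s" unfolding adjacent_def by blast
  have "atomic R (arr a s)" using C s atomic_arr_iff[OF f Suc.prems s(1)] by simp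
  then have c1: "card (inversions R (arr a s)) = 1" by (rule atoms)
  then have simp: "arr a s \<in> Collect (simple_mor R)"
    using Suc.prems s unfolding simple_mor_def by simp
  have sub: "chamber a - chamber s \<subseteq> chamber a - chamber b"
    using C s chamber_diff_subset_iff[OF Suc.prems s(1) b] by simp
  \<comment> \<open>As s lies below b at base a, the inversions from a to s are removed from those
    from a to b and no others are added.\<close>
  have "chamber s - chamber b = (chamber a - chamber b) - (chamber a - chamber s)"
    using C(2) s(2) sub unfolding sep_def by blast
  then have "card (chamber s - chamber b) = card (chamber a - chamber b) - card (chamber a - chamber s)"
    using sub finite_chamber[OF fin] by (simp add: card_Diff_subset)
  also have "card (chamber a - chamber s) = 1" using c1 card_inversions_arr[OF Suc.prems s(1)] by simp
  finally have n: "n = card (chamber s - chamber b)" using Suc(2) by simp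
  obtain fs where fs: "product_of R (Collect (simple_mor R)) fs (arr s b)" "length fs = n"
    using Suc(1)[OF n s(1)] n by auto
  have "product_of R (Collect (simple_mor R)) (arr a s # fs) (cmp R (arr a s) (arr s b))"
    by (rule product_Cons[OF simp fs(1)]) (use s b Suc.prems in simp)
  then show ?case using s b Suc.prems Suc(2) fs(2) by (metis cmp_arr length_Cons)
qed

text \<open>The number of inversions is subadditive under composition, by a triangle inequality for
  chamber differences, and each simple factor contributes one.\<close>

lemma product_of_simple_length:
  assumes fin: "finite_sgset R" and "product_of R (Collect (simple_mor R)) fs g"
  shows "g \<in> mor R \<and> card (inversions R g) \<le> length fs"
  using assms(2)
proof induction
  case (product_Nil a)
  then show ?case by (simp add: idt_arr inversions_arr)
next
  case (product_Cons f gs g)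
  then obtain a b c where ab: "a \<in> obj R" "b \<in> obj R" "c \<in> obj R" "f = arr a b" "g = arr b c"
    unfolding simple_mor_def using mor_arrE arr_simps(2,3) by (metis mem_Collect_eq)
  have "card (chamber a - chamber c) \<le> card ((chamber a - chamber b) \<union> (chamber b - chamber c))"
    by (rule card_mono) (use finite_chamber[OF fin] in auto)
  also have "\<dots> \<le> card (chamber a - chamber b) + card (chamber b - chamber c)" by (rule card_Un_le)
  finally have "card (inversions R (arr a c)) \<le> card (inversions R f) + card (inversions R g)"
    using ab by (simp add: card_inversions_arr)
  then show ?case using product_Cons ab by (simp add: simple_mor_def)
qed

lemma product_of_generated:
  assumes "product_of R A fs g"
  shows "g \<in> generated_subgroupoid R A"
  using assms by induction (auto intro: gen_base gen_idt gen_cmp)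

lemma principal_sgsetI:
  assumes fin: "finite_sgset R" and f: "faithful R"
    and atoms: "\<And>s. atomic R s \<Longrightarrow> card (inversions R s) = 1"
  shows "principal_sgset R"
proof -
  let ?A = "Collect (simple_mor R)"
  have ex: "\<exists>fs. product_of R ?A fs g \<and> length fs = card (inversions R g)" if g: "g \<in> mor R" for g
  proof -
    obtain a b where ab: "a \<in> obj R" "b \<in> obj R" "g = arr a b" using g by (rule mor_arrE)
    then show ?thesis
      using product_of_simple_exists[OF fin f atoms ab(1,2)] card_inversions_arr[OF ab(1,2)] by simp
  qed
  have "g \<in> mor R" if "g \<in> generated_subgroupoid R ?A" for g
    using that
  proof induction
    case (gen_cmp f g)
    then show ?case using mor_arrE arr_simps cmp_arr by metis
  next
    case (gen_inv f)
    then show ?case using mor_arrE arr_simps(1) ginv_arr by metis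
  qed (auto simp: simple_mor_def idt_arr)
  then have gen: "generated_subgroupoid R ?A = mor R" using ex product_of_generated by blast
  have "finite (inversions R g)" if "g \<in> mor R" for g
    using that finite_chamber[OF fin] by (auto elim!: mor_arrE simp: inversions_arr)
  then show ?thesis unfolding principal_sgset_def
    using gen ex product_of_simple_length[OF fin] by blast
qed

end

section \<open>Real compression\<close>

text \<open>Completeness and preprincipality involve the chambers only through inclusion and
  disjointness of separating sets, so indexed families with the same such relations share both
  properties.\<close>

lemma family_transfer:
  assumes sub: "\<And>a b c. a \<in> K \<Longrightarrow> b \<in> K \<Longrightarrow> c \<in> K \<Longrightarrow>
      sep (f a) (f b) \<subseteq> sep (f a) (f c) \<longleftrightarrow> sep (g a) (g b) \<subseteq> sep (g a) (g c)"
    and disj: "\<And>a b c. a \<in> K \<Longrightarrow> b \<in> K \<Longrightarrow> c \<in> K \<Longrightarrow>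
      sep (f a) (f b) \<inter> sep (f a) (f c) = {} \<longleftrightarrow> sep (g a) (g b) \<inter> sep (g a) (g c) = {}"
  shows "complete_family (f ` K) \<Longrightarrow> complete_family (g ` K)"
    "preprincipal_family (f ` K) \<Longrightarrow> preprincipal_family (g ` K)"
proof -
  assume c: "complete_family (f ` K)"
  show "complete_family (g ` K)" unfolding complete_family_def
  proof (intro ballI allI impI)
    fix A \<A> assume "A \<in> g ` K" "\<A> \<subseteq> g ` K"
    then obtain a B where a: "a \<in> K" "A = g a" and B: "B \<subseteq> K" "\<A> = g ` B"
      by (auto simp: subset_image_iff)
    have "f a \<in> f ` K" "f ` B \<subseteq> f ` K" using a B by auto
    then obtain J where J: "is_join (f ` K) (f a) (f ` B) J" using c unfolding complete_family_def by blast
    then obtain j where j: "j \<in> K" "J = f j" using is_joinD(1) by blast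
    have "(\<forall>b\<in>B. sep (f a) (f b) \<subseteq> sep (f a) (f u)) \<longleftrightarrow> (\<forall>b\<in>B. sep (g a) (g b) \<subseteq> sep (g a) (g u))"
      if "u \<in> K" for u
      using sub[OF a(1) _ that] B(1) by blast
    then have "is_join (g ` K) (g a) (g ` B) (g j)"
      using J j sub[OF a(1) j(1)] unfolding is_join_def by simp
    then show "\<exists>J. is_join (g ` K) A \<A> J" using a B by blast
  qed
next
  assume p: "preprincipal_family (f ` K)"
  \<comment> \<open>Two chambers coincide exactly when their separating set is disjoint from itself,
    so \<open>disj\<close> also transfers equality.\<close>
  have eq: "f a = f b \<longleftrightarrow> g a = g b" if "a \<in> K" "b \<in> K" for a b
    using disj[OF that(1) that(2) that(2)] by (simp add: sep_empty_iff)
  have "adjacent (g ` K) (g a) (g s) \<longleftrightarrow> adjacent (f ` K) (f a) (f s)" if "a \<in> K" "s \<in> K" for a s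
    unfolding adjacent_def using that eq sub[OF that(1) _ that(2)] by auto
  then show "preprincipal_family (g ` K)"
    using p sub disj unfolding preprincipal_family_def by simp
qed

section \<open>Real roots and their parallelism classes\<close>

context indiscrete_sgset
begin

abbreviation cls :: "'o \<Rightarrow> 'r \<Rightarrow> 'r set" where
  "cls a \<alpha> \<equiv> parallel R a `` {\<alpha>}"

lemma parallel_iff:
  assumes "a \<in> obj R"
  shows "(\<alpha>, \<beta>) \<in> parallel R a \<longleftrightarrow> \<alpha> \<in> roots R a \<and> \<beta> \<in> roots R a \<and>
    (\<forall>b\<in>obj R. act R (arr b a) \<alpha> \<in> pos R b \<longleftrightarrow> act R (arr b a) \<beta> \<in> pos R b)"
  unfolding parallel_def using assms by (auto simp: homs_to_eq)

lemma equiv_parallel: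
  assumes "a \<in> obj R"
  shows "equiv (roots R a) (parallel R a)"
  by (rule equivI)
    (auto simp: parallel_iff[OF assms] refl_on_def sym_def trans_def)

lemma cls_eq_iff:
  assumes "a \<in> obj R" "\<alpha> \<in> roots R a" "\<beta> \<in> roots R a"
  shows "cls a \<alpha> = cls a \<beta> \<longleftrightarrow> (\<alpha>, \<beta>) \<in> parallel R a"
  using eq_equiv_class_iff[OF equiv_parallel] assms by blast

text \<open>For positive \<alpha> the only positive witness in the definition is \<alpha> itself,
  for negative \<alpha> it is the negative of \<alpha>. In both cases the condition says that the
  sign never changes.\<close>

lemma imaginary_iff:
  assumes a: "a \<in> obj R" and \<alpha>: "\<alpha> \<in> roots R a"
  shows "imaginary R a \<alpha> \<longleftrightarrow> (\<forall>b\<in>obj R. act R (arr b a) \<alpha> \<in> pos R b \<longleftrightarrow> \<alpha> \<in> pos R a)"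
proof -
  have pos_case: "(\<forall>g\<in>homs_to R a. \<beta> \<notin> inversions R g) \<longleftrightarrow> (\<forall>b\<in>obj R. act R (arr b a) \<beta> \<in> pos R b)"
    if "\<beta> \<in> pos R a" for \<beta>
    using that a by (simp add: homs_to_eq inversions_arr_iff)
  show ?thesis
  proof (cases "\<alpha> \<in> pos R a")
    case True
    then have "\<beta> = \<alpha>" if "\<beta> \<in> pos R a" "\<alpha> = \<beta> \<or> \<alpha> = rneg R a \<beta>" for \<beta>
      using that a pos_roots rneg_pos_iff by blast
    then have "imaginary R a \<alpha> \<longleftrightarrow> (\<forall>g\<in>homs_to R a. \<alpha> \<notin> inversions R g)"
      using True unfolding imaginary_def by metis
    then show ?thesis using True pos_case[OF True] by simp
  next
    case False
    then have "\<beta> = rneg R a \<alpha>" if "\<beta> \<in> pos R a" "\<alpha> = \<beta> \<or> \<alpha> = rneg R a \<beta>" for \<beta>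
      using that a pos_roots by auto
    moreover have npos: "rneg R a \<alpha> \<in> pos R a" using False a \<alpha> by (simp add: rneg_pos_iff)
    moreover have "\<alpha> = rneg R a (rneg R a \<alpha>)" using a \<alpha> by simp
    ultimately have "imaginary R a \<alpha> \<longleftrightarrow> (\<forall>b\<in>obj R. act R (arr b a) (rneg R a \<alpha>) \<in> pos R b)"
      using pos_case[OF npos] unfolding imaginary_def by metis
    then show ?thesis using False a \<alpha> by (simp add: act_arr_neg rneg_pos_iff)
  qed
qed

text \<open>Here a no longer plays a special part among the objects, which makes invariance under
  the action and under negation immediate.\<close>

lemma real_roots_iff:
  assumes a: "a \<in> obj R"
  shows "\<alpha> \<in> real_roots R a \<longleftrightarrow> \<alpha> \<in> roots R a \<and>
    (\<exists>b\<in>obj R. \<exists>c\<in>obj R. act R (arr b a) \<alpha> \<in> pos R b \<and> act R (arr c a) \<alpha> \<notin> pos R c)"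
proof (cases "\<alpha> \<in> roots R a")
  case True
  then have "act R (arr a a) \<alpha> = \<alpha>" using a by simp
  then show ?thesis unfolding real_roots_def mem_Collect_eq imaginary_iff[OF a True]
    using True a by metis
qed (simp add: real_roots_def)

lemma real_roots_act:
  assumes "a \<in> obj R" "b \<in> obj R" "\<alpha> \<in> real_roots R b"
  shows "act R (arr a b) \<alpha> \<in> real_roots R a"
  using assms by (auto simp: real_roots_iff)

lemma real_roots_rneg:
  assumes "a \<in> obj R" "\<alpha> \<in> real_roots R a"
  shows "rneg R a \<alpha> \<in> real_roots R a"
  using assms by (auto simp: real_roots_iff act_arr_neg rneg_pos_iff)

lemma real_roots_roots: "\<alpha> \<in> real_roots R a \<Longrightarrow> \<alpha> \<in> roots R a"
  unfolding real_roots_def by blast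

lemma real_compression_simps:
  "obj (real_compression R) = obj R" "mor (real_compression R) = mor R"
  "src (real_compression R) = src R" "tgt (real_compression R) = tgt R"
  "idt (real_compression R) = idt R" "cmp (real_compression R) = cmp R"
  "homs (real_compression R) = homs R" "homs_to (real_compression R) = homs_to R"
  "is_inverse (real_compression R) = is_inverse R"
  by (auto simp: fun_eq_iff real_compression_def homs_def homs_to_def is_inverse_def)

lemma roots_real_compression: "roots (real_compression R) a = cls a ` real_roots R a"
  by (auto simp: real_compression_def quotient_def)

lemma pos_real_compression: "pos (real_compression R) a = cls a ` (real_roots R a \<inter> pos R a)"
  by (auto simp: real_compression_def quotient_def)

text \<open>Negatives of parallel roots are parallel, so the union over a class collapses to a
  single class. The action is treated in the same way.\<close>

lemma rneg_real_compression:
  assumes a: "a \<in> obj R" and "\<alpha> \<in> roots R a"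
  shows "rneg (real_compression R) a (cls a \<alpha>) = cls a (rneg R a \<alpha>)"
proof -
  have "(\<lambda>\<alpha>. cls a (rneg R a \<alpha>)) respects parallel R a"
    by (rule congruentI)
      (use a in \<open>auto simp: cls_eq_iff parallel_iff act_arr_neg rneg_pos_iff\<close>)
  from UN_equiv_class[OF equiv_parallel[OF a] this assms(2)] show ?thesis
    by (simp add: real_compression_def)
qed

lemma act_real_compression:
  assumes a: "a \<in> obj R" and b: "b \<in> obj R" and "\<alpha> \<in> roots R b"
  shows "act (real_compression R) (arr a b) (cls b \<alpha>) = cls a (act R (arr a b) \<alpha>)"
proof -
  have "(\<lambda>\<alpha>. cls a (act R (arr a b) \<alpha>)) respects parallel R b"
    by (rule congruentI) (use a b in \<open>auto simp: cls_eq_iff parallel_iff\<close>)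
  from UN_equiv_class[OF equiv_parallel[OF b] this assms(3)] show ?thesis
    using a b by (simp add: real_compression_def)
qed

text \<open>Testing parallelism on the identity compares signs at a itself, so a class never mixes
  signs.\<close>

lemma cls_pos_iff:
  assumes a: "a \<in> obj R" and \<alpha>: "\<alpha> \<in> real_roots R a"
  shows "cls a \<alpha> \<in> pos (real_compression R) a \<longleftrightarrow> \<alpha> \<in> pos R a"
proof
  assume "cls a \<alpha> \<in> pos (real_compression R) a"
  then obtain \<beta> where \<beta>: "\<beta> \<in> real_roots R a" "\<beta> \<in> pos R a" "cls a \<alpha> = cls a \<beta>"
    unfolding pos_real_compression by blast
  then have "(\<alpha>, \<beta>) \<in> parallel R a" using cls_eq_iff a \<alpha> real_roots_roots by blast
  then show "\<alpha> \<in> pos R a" using \<beta>(2) a parallel_iff by fastforce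
qed (use \<alpha> pos_real_compression in blast)

lemma real_compression_involuted:
  assumes a: "a \<in> obj R"
  shows "definitely_involuted_set (roots (real_compression R) a) (pos (real_compression R) a)
    (rneg (real_compression R) a)" (is "definitely_involuted_set ?E ?P ?n")
proof -
  have n: "?n (cls a \<alpha>) = cls a (rneg R a \<alpha>)" if "\<alpha> \<in> real_roots R a" for \<alpha>
    using rneg_real_compression[OF a] real_roots_roots that by blast
  have pn: "cls a (rneg R a \<alpha>) \<in> ?P \<longleftrightarrow> cls a \<alpha> \<notin> ?P" if "\<alpha> \<in> real_roots R a" for \<alpha>
    using that a real_roots_rneg real_roots_roots by (simp add: cls_pos_iff rneg_pos_iff)
  have nn: "rneg R a (rneg R a \<alpha>) = \<alpha>" if "\<alpha> \<in> real_roots R a" for \<alpha>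
    using that a real_roots_roots by simp
  have P: "?P \<subseteq> ?E" unfolding roots_real_compression pos_real_compression by blast
  \<comment> \<open>That negation exchanges positivity and its absence gives both freeness from
    fixed points and disjointness of the two halves.\<close>
  have inv: "?n x \<in> ?E \<and> ?n (?n x) = x \<and> (?n x \<in> ?P \<longleftrightarrow> x \<notin> ?P)" if x: "x \<in> ?E" for x
  proof -
    obtain \<alpha> where \<alpha>: "\<alpha> \<in> real_roots R a" "x = cls a \<alpha>" using x roots_real_compression by auto
    then show ?thesis using n pn nn real_roots_rneg[OF a] roots_real_compression by auto
  qed
  have "x \<in> ?P \<union> ?n ` ?P" if x: "x \<in> ?E" for x
  proof (cases "x \<in> ?P")
    case False
    then have "?n x \<in> ?P" "x = ?n (?n x)" using inv[OF x] by auto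
    then show ?thesis by blast
  qed blast
  moreover have "?n ` ?P \<subseteq> ?E" using inv P by blast
  moreover have "?P \<inter> ?n ` ?P = {}"
  proof -
    have "?n x \<notin> ?P" if "x \<in> ?P" for x using inv[OF subsetD[OF P that]] that by simp
    then show ?thesis by blast
  qed
  moreover have "?n x \<noteq> x" if "x \<in> ?E" for x
  proof
    assume "?n x = x"
    then show False using inv[OF that] by simp
  qed
  moreover have "?n x \<in> ?E" "?n (?n x) = x" if "x \<in> ?E" for x using inv[OF that] by auto
  ultimately show ?thesis using P unfolding definitely_involuted_set_def
    by (intro conjI ballI equalityI subsetI) auto
qed

lemma real_compression_indiscrete: "indiscrete_sgset (real_compression R) base"
proof
  let ?C = "real_compression R"
  note [simp] = real_compression_simps
  show "groupoid_connected ?C" "groupoid_simply_connected ?C" "base \<in> obj ?C"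
    using connected simply_connected base
    unfolding groupoid_connected_def groupoid_simply_connected_def by simp_all
  show "src ?C f \<in> obj ?C" "tgt ?C f \<in> obj ?C" if "f \<in> mor ?C" for f
    using that src_closed tgt_closed by simp_all
  show "idt ?C a \<in> homs ?C a a" if "a \<in> obj ?C" for a using that idt_closed by simp
  show "cmp ?C f g \<in> homs ?C a c" if "f \<in> homs ?C a b" "g \<in> homs ?C b c" for f g a b c
    using that cmp_closed by simp
  show "cmp ?C (cmp ?C f g) h = cmp ?C f (cmp ?C g h)"
    if "f \<in> homs ?C a b" "g \<in> homs ?C b c" "h \<in> homs ?C c d" for f g h a b c d
    using that cmp_assoc by simp
  show "cmp ?C (idt ?C a) f = f" "cmp ?C f (idt ?C b) = f" if "f \<in> homs ?C a b" for f a b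
    using that cmp_idt_left cmp_idt_right by simp_all
  show "\<exists>g. is_inverse ?C f g" if "f \<in> mor ?C" for f using that inverse_exists by simp
  show "definitely_involuted_set (roots ?C a) (pos ?C a) (rneg ?C a)" if "a \<in> obj ?C" for a
    using that real_compression_involuted by simp
  have arrD: "a \<in> obj R \<and> b \<in> obj R \<and> f = arr a b" if "f \<in> homs ?C a b" for f a b
    using that homs_objD arr_eqI by (metis real_compression_simps(7))
  show "act ?C f x \<in> roots ?C a" if "f \<in> homs ?C a b" "x \<in> roots ?C b" for f a b x
    using arrD[OF that(1)] that(2) real_roots_act real_roots_roots
    by (auto simp: roots_real_compression act_real_compression)
  show "act ?C (idt ?C a) x = x" if "a \<in> obj ?C" "x \<in> roots ?C a" for a x
    using that real_roots_roots by (auto simp: roots_real_compression act_real_compression idt_arr)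
  show "act ?C f (act ?C g x) = act ?C (cmp ?C f g) x"
    if "f \<in> homs ?C a b" "g \<in> homs ?C b c" "x \<in> roots ?C c" for f g a b c x
    using arrD[OF that(1)] arrD[OF that(2)] that(3) real_roots_roots
    by (auto simp: roots_real_compression act_real_compression)
  show "act ?C f (rneg ?C b x) = rneg ?C a (act ?C f x)"
    if "f \<in> homs ?C a b" "x \<in> roots ?C b" for f a b x
    using arrD[OF that(1)] that(2) real_roots_roots
    by (auto simp: roots_real_compression act_real_compression rneg_real_compression act_arr_neg)
qed

lemma real_compression_arr: "indiscrete_sgset.arr (real_compression R) = arr"
  unfolding fun_eq_iff indiscrete_sgset.arr_def[OF real_compression_indiscrete] arr_def
  by (simp add: real_compression_simps)

section \<open>Inversion sets and weak orders after real compression\<close>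

lemma inversions_real:
  assumes "a \<in> obj R" "b \<in> obj R" "\<alpha> \<in> inversions R (arr a b)"
  shows "\<alpha> \<in> real_roots R a"
proof -
  have \<alpha>: "\<alpha> \<in> pos R a" "act R (arr b a) \<alpha> \<notin> pos R b" "\<alpha> \<in> roots R a"
    using assms pos_roots by (auto simp: inversions_arr_iff)
  then have "act R (arr a a) \<alpha> \<in> pos R a" using assms by simp
  with \<alpha> show ?thesis using assms(1,2) real_roots_iff by blast
qed

lemma cls_inversions_iff:
  assumes a: "a \<in> obj R" and b: "b \<in> obj R" and \<alpha>: "\<alpha> \<in> real_roots R a"
  shows "cls a \<alpha> \<in> inversions (real_compression R) (arr a b) \<longleftrightarrow> \<alpha> \<in> inversions R (arr a b)"
proof -
  interpret C: indiscrete_sgset "real_compression R" base by (rule real_compression_indiscrete)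
  have "act (real_compression R) (arr b a) (cls a \<alpha>) = cls b (act R (arr b a) \<alpha>)"
    using act_real_compression[OF b a] real_roots_roots[OF \<alpha>] .
  then show ?thesis
    using C.inversions_arr_iff[of a b "cls a \<alpha>"] inversions_arr_iff[OF a b]
      cls_pos_iff[OF a \<alpha>] cls_pos_iff[OF b real_roots_act[OF b a \<alpha>]] a b
    by (simp add: real_compression_simps real_compression_arr)
qed

lemma inversions_real_compression:
  assumes a: "a \<in> obj R" and b: "b \<in> obj R"
  shows "inversions (real_compression R) (arr a b) = cls a ` inversions R (arr a b)"
proof
  have "inversions (real_compression R) (arr a b) \<subseteq> pos (real_compression R) a"
    using assms by (auto simp: inversions_def real_compression_simps)
  then show "inversions (real_compression R) (arr a b) \<subseteq> cls a ` inversions R (arr a b)"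
    using cls_inversions_iff[OF a b] unfolding pos_real_compression by blast
qed (use cls_inversions_iff[OF a b] inversions_real[OF a b] in blast)

text \<open>Inversion sets are unions of parallelism classes, so passing to classes preserves and
  reflects inclusion and disjointness.\<close>

lemma real_compression_sep_iff:
  assumes "a \<in> obj R" "b \<in> obj R" "c \<in> obj R"
  defines "ch \<equiv> indiscrete_sgset.chamber (real_compression R) base"
  shows "sep (chamber a) (chamber b) \<subseteq> sep (chamber a) (chamber c) \<longleftrightarrow>
      sep (ch a) (ch b) \<subseteq> sep (ch a) (ch c)"
    "sep (chamber a) (chamber b) \<inter> sep (chamber a) (chamber c) = {} \<longleftrightarrow>
      sep (ch a) (ch b) \<inter> sep (ch a) (ch c) = {}"
proof -
  interpret C: indiscrete_sgset "real_compression R" base by (rule real_compression_indiscrete)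
  let ?I = "inversions R" and ?J = "inversions (real_compression R)"
  have mem: "cls a \<alpha> \<in> ?J (arr a b') \<longleftrightarrow> \<alpha> \<in> ?I (arr a b')" if "\<alpha> \<in> ?I (arr a b)" "b' \<in> obj R" for \<alpha> b'
    using cls_inversions_iff inversions_real assms(1,2) that by blast
  have J: "?J (arr a b) = cls a ` ?I (arr a b)" by (rule inversions_real_compression[OF assms(1,2)])
  have "?I (arr a b) \<subseteq> ?I (arr a c) \<longleftrightarrow> ?J (arr a b) \<subseteq> ?J (arr a c)"
    unfolding J using mem assms(3) by blast
  then show "sep (chamber a) (chamber b) \<subseteq> sep (chamber a) (chamber c) \<longleftrightarrow>
      sep (ch a) (ch b) \<subseteq> sep (ch a) (ch c)"
    using inversions_subset_iff[OF assms(1-3)] C.inversions_subset_iff[of a b c] assms(1-3)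
    unfolding ch_def by (simp add: real_compression_simps real_compression_arr)
  have "?I (arr a b) \<inter> ?I (arr a c) = {} \<longleftrightarrow> ?J (arr a b) \<inter> ?J (arr a c) = {}"
    unfolding J using mem assms(3) by blast
  then show "sep (chamber a) (chamber b) \<inter> sep (chamber a) (chamber c) = {} \<longleftrightarrow>
      sep (ch a) (ch b) \<inter> sep (ch a) (ch c) = {}"
    using inversions_disjoint_iff[OF assms(1-3)] C.inversions_disjoint_iff[of a b c] assms(1-3)
    unfolding ch_def by (simp add: real_compression_simps real_compression_arr)
qed

theorem real_compression_properties:
  assumes f: "faithful R" and fin: "finite_sgset R" and pre: "preprincipal R"
    and comp: "complete_sgset R"
  shows "finite_sgset (real_compression R)" "preprincipal (real_compression R)"
    "complete_sgset (real_compression R)" "real_sgset (real_compression R)"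
    "principal_sgset (real_compression R)"
proof -
  let ?C = "real_compression R"
  interpret C: indiscrete_sgset ?C base by (rule real_compression_indiscrete)
  note [simp] = real_compression_simps real_compression_arr
  have "finite (roots ?C a)" if "a \<in> obj R" for a
    using that fin unfolding finite_sgset_def roots_real_compression real_roots_def by simp
  then show finC: "finite_sgset ?C" using fin unfolding finite_sgset_def by simp
  have "chamber a = chamber b \<longleftrightarrow> C.chamber a = C.chamber b" if "a \<in> obj R" "b \<in> obj R" for a b
    using real_compression_sep_iff(2)[OF that that(2)] by (simp add: sep_empty_iff)
  then have fC: "faithful ?C"
    using f unfolding C.faithful_iff faithful_iff by (simp add: inj_on_def)
  show "complete_sgset ?C"
    using comp family_transfer(1)[of "obj R" chamber C.chamber, OF real_compression_sep_iff]
    unfolding C.complete_sgset_iff[OF fC] complete_sgset_iff[OF f] by simp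
  show preC: "preprincipal ?C"
    using pre family_transfer(2)[of "obj R" chamber C.chamber, OF real_compression_sep_iff]
    unfolding C.preprincipal_iff[OF fC finC] preprincipal_iff[OF f fin] by simp
  show "real_sgset ?C" unfolding real_sgset_def
  proof (intro ballI)
    fix a x assume "a \<in> obj ?C" and x: "x \<in> roots ?C a"
    then obtain \<alpha> where a: "a \<in> obj R" and \<alpha>: "\<alpha> \<in> real_roots R a" "x = cls a \<alpha>"
      by (auto simp: roots_real_compression)
    \<comment> \<open>A class has the same sign at every object as its representative \<alpha>, and
      \<alpha> changes sign because it is real.\<close>
    have "act ?C (arr b a) x \<in> pos ?C b \<longleftrightarrow> act R (arr b a) \<alpha> \<in> pos R b" if "b \<in> obj R" for b
      using act_real_compression[OF that a real_roots_roots[OF \<alpha>(1)]]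
        cls_pos_iff[OF that real_roots_act[OF that a \<alpha>(1)]] \<alpha>(2) by simp
    then show "\<not> imaginary ?C a x"
      using \<alpha>(1) a C.imaginary_iff[OF _ x] real_roots_iff[OF a, of \<alpha>] by auto
  qed
  show "principal_sgset ?C"
  proof (rule C.principal_sgsetI[OF finC fC])
    fix s assume s: "atomic ?C s"
    then obtain a b where ab: "a \<in> obj R" "b \<in> obj R" "s = arr a b"
      unfolding atomic_def by (auto elim: mor_arrE)
    have "C.chamber b \<noteq> C.chamber a"
      using s ab C.atomic_arr_iff[OF fC, of a b] unfolding adjacent_def by simp
    then have "inversions ?C s \<noteq> {}" using ab C.inversions_empty_iff[of a b] by auto
    moreover have "x = y" if xy: "x \<in> inversions ?C s" "y \<in> inversions ?C s" for x y
    proof -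
      obtain \<alpha> \<beta> where \<alpha>: "\<alpha> \<in> inversions R s" "x = cls a \<alpha>" and \<beta>: "\<beta> \<in> inversions R s" "y = cls a \<beta>"
        using xy inversions_real_compression[OF ab(1,2)] ab(3) by auto
      then have real: "\<alpha> \<in> real_roots R a" "\<beta> \<in> real_roots R a" using inversions_real ab by blast+
      have pos: "\<alpha> \<in> pos R a" "\<beta> \<in> pos R a" using \<alpha> \<beta> ab by (auto simp: inversions_arr_iff)
      \<comment> \<open>By preprincipality each inversion set contains all of the inversions of the
        atom s or none. The positive representatives \<alpha> and \<beta> therefore have equal signs
        at every object, so they are parallel and their classes coincide.\<close>
      have "\<alpha> \<in> inversions R (arr a c) \<longleftrightarrow> \<beta> \<in> inversions R (arr a c)" if c: "c \<in> obj R" for c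
      proof -
        have "arr a c \<in> homs_to R a" "s \<in> homs_to R a" using ab c by (auto simp: homs_to_eq)
        then have "inversions ?C s \<subseteq> inversions ?C (arr a c) \<or> inversions ?C s \<inter> inversions ?C (arr a c) = {}"
          using preC s ab(1) unfolding preprincipal_def by simp
        then have "x \<in> inversions ?C (arr a c) \<longleftrightarrow> y \<in> inversions ?C (arr a c)" using xy by blast
        then show ?thesis using cls_inversions_iff[OF ab(1) c] real \<alpha>(2) \<beta>(2) by blast
      qed
      then have "(\<alpha>, \<beta>) \<in> parallel R a"
        using pos real real_roots_roots ab(1) by (simp add: parallel_iff inversions_arr_iff)
      then show ?thesis using cls_eq_iff ab(1) real real_roots_roots \<alpha>(2) \<beta>(2) by blast
    qed
    ultimately have "\<exists>x. inversions ?C s = {x}" by blast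
    then show "card (inversions ?C s) = 1" by auto
  qed
qed

end

section \<open>The result for a component and its real compression\<close>

theorem corollary3p18:
  fixes R :: "('o, 'm, 'r) sgset"
    and S :: "('o \<times> 'm set, ('o \<times> 'm set) \<times> 'm \<times> ('o \<times> 'm set), 'r) sgset"
  assumes "signed_groupoid_set R"
    and "finite_sgset R"
    and "groupoid_connected R"
    and "groupoid_simply_connected R"
    and "preprincipal R"
    and "complete_sgset R"
    and "connected_component_of S (box_sgset R)"
  shows "(signed_groupoid_set S \<and> finite_sgset S \<and>
          groupoid_connected S \<and> groupoid_simply_connected S \<and>
          preprincipal S \<and> complete_sgset S) \<and>
         (signed_groupoid_set (real_compression S) \<and> finite_sgset (real_compression S) \<and>
          groupoid_connected (real_compression S) \<and>
          groupoid_simply_connected (real_compression S) \<and>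
          preprincipal (real_compression S) \<and> complete_sgset (real_compression S) \<and>
          real_sgset (real_compression S) \<and> principal_sgset (real_compression S))"
proof -
  have f: "faithful R" using assms(5) unfolding preprincipal_def by blast
  obtain p where p: "p \<in> obj (box_sgset R)"
    and S: "S = restrict_sgset (box_sgset R) {q \<in> obj (box_sgset R). homs (box_sgset R) q p \<noteq> {}}"
    using assms(7) unfolding connected_component_of_def by blast
  have "fst p \<in> obj R" using p by (auto simp: box_sgset_def)
  \<comment> \<open>The base of R is taken under the object p that selects the component, so that
    chambers of S computed at p are chambers of R.\<close>
  then interpret R: indiscrete_sgset R "fst p"
    using assms(1,3,4) by (intro indiscrete_sgset.intro indiscrete_sgset_axioms.intro)
  have S: "S = R.box_part (R.trace p)" unfolding S by (rule R.component_box_part[OF f p])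
  have pS: "p \<in> obj S" using p unfolding S by (auto simp: R.box_obj R.box_part_obj)
  interpret S: indiscrete_sgset S p
    using R.box_part_indiscrete[OF f pS[unfolded S]] unfolding S .
  have S1: "finite_sgset S" "preprincipal S" "complete_sgset S"
    using R.box_part_properties[OF f assms(2,5,6) pS[unfolded S] refl] unfolding S by auto
  have fS: "faithful S" using S1(2) unfolding preprincipal_def by blast
  interpret C: indiscrete_sgset "real_compression S" p by (rule S.real_compression_indiscrete)
  show ?thesis
    using S1 S.real_compression_properties[OF fS S1] S.signed_groupoid_set_axioms
      S.connected S.simply_connected C.signed_groupoid_set_axioms C.connected C.simply_connected
    by blast
qed

end
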